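(* Let $\Phi_1,\Phi_2\in\mathscr{L}\cup\mathscr{U}$ and $\alpha,\beta>-1$, and assume $\Phi_2/\Phi_1$ is non-decreasing. Then $A^{\Phi_1}_\alpha(\mathbb{B}^n)$ embeds continuously into $A^{\Phi_2}_\beta(\mathbb{B}^n)$ (i.e. $A^{\Phi_1}_\alpha(\mathbb{B}^n)\subset A^{\Phi_2}_\beta(\mathbb{B}^n)$ and there is $C>0$ with $\|f\|^{lux}_{\Phi_2,\beta}\le C\|f\|^{lux}_{\Phi_1,\alpha}$ for all $f\in A^{\Phi_1}_\alpha(\mathbb{B}^n)$) if and only if there is a constant $C>0$ such that $$\Phi_1^{-1}(t^{n+1+\alpha})\le\Phi_2^{-1}(Ct^{n+1+\beta})\quad\text{for all }t\in[1,\infty).$$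
   Context: $\mathbb{B}^n$ is the open unit ball of $\mathbb{C}^n$. $d\nu$ is Lebesgue measure on $\mathbb{B}^n$ and, for $\alpha>-1$, $d\nu_\alpha(z)=c_\alpha(1-|z|^2)^\alpha d\nu(z)$ with $\nu_\alpha(\mathbb{B}^n)=1$. A growth function is a continuous non-decreasing function from $[0,\infty)$ onto $[0,\infty)$, normalized so that $\Phi(1)=1$. $\Phi$ is of upper type $q>0$ if $\Phi(st)\le Ct^q\Phi(s)$ for all $s>0,t\ge1$; of lower type $p>0$ if $\Phi(st)\le Ct^p\Phi(s)$ for all $s>0$, $0<t\le1$. $\mathscr{U}=\bigcup_{q\ge1}\mathscr{U}^q$ where $\mathscr{U}^q$ is the set of growth functions of upper type $q$ with $\Phi(t)/t$ non-decreasing; $\mathscr{L}=\bigcup_{0<p\le1}\mathscr{L}_p$ where $\mathscr{L}_p$ is the set of growth functions of lower type $p$ with $\Phi(t)/t$ non-increasing. The Bergman–Orlicz space $A^\Phi_\alpha(\mathbb{B}^n)$ is the set of holomorphic $f$ on $\mathbb{B}^n$ with $\int\Phi(|f|)\,d\nu_\alpha<\infty$, with Luxemburg quasi-norm $\|f\|^{lux}_{\Phi,\alpha}=\inf\{\lambda>0:\int_{\mathbb{B}^n}\Phi(|f(z)|/\lambda)\,d\nu_\alpha(z)\le1\}$. *)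

theory Defs
  imports "HOL-Analysis.Analysis"
begin

definition unit_ball :: "(complex ^ 'n::finite) set" where
  "unit_ball = ball 0 1"

definition holo_ball :: "(complex ^ 'n::finite \<Rightarrow> complex) \<Rightarrow> bool" where
  "holo_ball f \<longleftrightarrow> (\<forall>z\<in>unit_ball. \<exists>D. (f has_derivative D) (at z) \<and>
      (\<forall>c v. D (c *s v) = c * D v))"

definition weight_const :: "real \<Rightarrow> 'n::finite itself \<Rightarrow> real" where
  "weight_const \<alpha> _ = 1 / enn2real (\<integral>\<^sup>+ z. indicator (unit_ball :: (complex^'n) set) z *
        ennreal ((1 - (norm z)\<^sup>2) powr \<alpha>) \<partial>lborel)"

definition nu :: "real \<Rightarrow> (complex ^ 'n::finite) measure" where
  "nu \<alpha> = density lborel (\<lambda>z. indicator unit_ball z *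
        ennreal (weight_const \<alpha> TYPE('n) * (1 - (norm z)\<^sup>2) powr \<alpha>))"

definition growth_fun :: "(real \<Rightarrow> real) \<Rightarrow> bool" where
  "growth_fun \<Phi> \<longleftrightarrow> continuous_on {0..} \<Phi> \<and> mono_on {0..} \<Phi> \<and>
     \<Phi> ` {0..} = {0..} \<and> \<Phi> 1 = 1"

definition upper_type :: "(real \<Rightarrow> real) \<Rightarrow> real \<Rightarrow> bool" where
  "upper_type \<Phi> q \<longleftrightarrow> (\<exists>C. \<forall>s>0. \<forall>t\<ge>1. \<Phi> (s * t) \<le> C * t powr q * \<Phi> s)"

definition lower_type :: "(real \<Rightarrow> real) \<Rightarrow> real \<Rightarrow> bool" where
  "lower_type \<Phi> p \<longleftrightarrow> (\<exists>C. \<forall>s>0. \<forall>t. 0 < t \<and> t \<le> 1 \<longrightarrow> \<Phi> (s * t) \<le> C * t powr p * \<Phi> s)"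

definition U_class :: "(real \<Rightarrow> real) set" where
  "U_class = {\<Phi>. \<exists>q\<ge>1. growth_fun \<Phi> \<and> upper_type \<Phi> q \<and> mono_on {0<..} (\<lambda>t. \<Phi> t / t)}"

definition L_class :: "(real \<Rightarrow> real) set" where
  "L_class = {\<Phi>. \<exists>p. 0 < p \<and> p \<le> 1 \<and> growth_fun \<Phi> \<and> lower_type \<Phi> p \<and>
      antimono_on {0<..} (\<lambda>t. \<Phi> t / t)}"

definition bergman_orlicz :: "(real \<Rightarrow> real) \<Rightarrow> real \<Rightarrow> (complex ^ 'n::finite \<Rightarrow> complex) set" where
  "bergman_orlicz \<Phi> \<alpha> = {f. holo_ball f \<and>
      (\<integral>\<^sup>+ z. ennreal (\<Phi> (norm (f z))) \<partial>nu \<alpha>) < \<infinity>}"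

definition lux_norm :: "(real \<Rightarrow> real) \<Rightarrow> real \<Rightarrow> (complex ^ 'n::finite \<Rightarrow> complex) \<Rightarrow> real" where
  "lux_norm \<Phi> \<alpha> f = Inf {r::real. 0 < r \<and>
      (\<integral>\<^sup>+ z. ennreal (\<Phi> (norm (f z) / r)) \<partial>nu \<alpha>) \<le> 1}"

text \<open>(Generalized) inverse of a growth function: the least preimage.\<close>
definition ginv :: "(real \<Rightarrow> real) \<Rightarrow> real \<Rightarrow> real" where
  "ginv \<Phi> y = Inf {t. 0 \<le> t \<and> y \<le> \<Phi> t}"

end

theory Submission
  imports Defs "HOL-Complex_Analysis.Cauchy_Integral_Formula"
begin

text \<open>
  Functions in either class satisfy power bounds from both sides,
  \<open>\<Phi> (s t) \<le> A t\<^sup>p \<Phi> s\<close> for \<open>t \<le> 1\<close> and \<open>\<Phi> (s t) \<le> A t\<^sup>q \<Phi> s\<close> for \<open>t \<ge> 1\<close>, and nothing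
  else about them matters. Write \<open>N = n + 1 + \<alpha>\<close> and \<open>M = n + 1 + \<beta>\<close>; the growth condition says that
  \<open>\<Phi>2 (\<Phi>1\<^sup>-\<^sup>1 (t\<^sup>N))\<close> is \<open>O (t\<^sup>M)\<close>.

  A weak mean value property for \<open>\<Phi> (\<bar>f\<bar>)\<close>, applied on ellipsoids of size \<open>1 - \<bar>z\<bar>\<close> in the complex
  direction of \<open>z\<close> and of size \<open>(1 - \<bar>z\<bar>)\<^sup>1\<^sup>/\<^sup>2\<close> in the orthogonal directions, gives
  \<open>\<Phi> (\<bar>f z\<bar>) \<le> C (1 - \<bar>z\<bar>)\<^sup>-\<^sup>N \<integral> \<Phi> (\<bar>f\<bar>) d\<nu>\<^sub>\<alpha>\<close>. Inserting this bound into the non-decreasing quotient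
  \<open>\<Phi>2 / \<Phi>1\<close> yields the embedding. Conversely, the functions
  \<open>\<Phi>1\<^sup>-\<^sup>1 (u\<^sup>-\<^sup>N) (u / (1 - (1 - u) z\<^sub>k))\<^sup>\<kappa>\<close> with \<open>\<kappa>\<close> large are bounded in the first space, and the
  pointwise bound for the second space at \<open>z = (1 - u) e\<^sub>k\<close> gives the growth condition with \<open>t = 1 / u\<close>.
\<close>

section \<open>Invariance of Lebesgue measure\<close>

text \<open>Two obstacles shape the argument. A function in \<open>L_class\<close> may be far from
  convex and even constant on intervals, so \<open>\<Phi>\<close> of |f| need not be subharmonic and
  a mean value inequality has to come from the power bounds alone. For the same reason
  \<open>ginv\<close> is only a right inverse: the growth condition is handled as a bound on
  \<open>\<Phi>2 (ginv \<Phi>1 ...)\<close>, and strict inequalities are arranged wherever an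
  inequality between values has to be turned into one between arguments. The converse succeeds
  because the pointwise bound is sharp: up to constants, \<open>ginv \<Phi>1 (u powr - N)\<close> is
  the largest size that it allows at distance \<open>u\<close> from the sphere, and the test
  functions reach this size while their modular stays bounded. A small lower type \<open>p\<close>
  makes \<open>\<Phi>1\<close> decay slowly along the kernel, which is compensated by a large power
  of the kernel. Passing between modulars and Luxemburg norms uses only the power bounds, never a
  triangle inequality.\<close>

lemma nn_integral_lborel_diagonal:
  fixes g :: "'a::euclidean_space \<Rightarrow> ennreal"
  assumes [measurable]: "g \<in> borel_measurable borel"
    and c: "\<And>j. j \<in> Basis \<Longrightarrow> c j \<noteq> 0"
  shows "(\<integral>\<^sup>+x. g x \<partial>lborel) =
    ennreal (\<Prod>j\<in>Basis. \<bar>c j\<bar>) * (\<integral>\<^sup>+x. g (t + (\<Sum>j\<in>Basis. (c j * (x \<bullet> j)) *\<^sub>R j)) \<partial>lborel)"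
  by (subst lborel_affine_euclidean[where c=c and t=t])
    (auto simp: c nn_integral_density nn_integral_distr nn_integral_cmult)

lemma nn_integral_lborel_scale:
  fixes g :: "'a::euclidean_space \<Rightarrow> ennreal"
  assumes [measurable]: "g \<in> borel_measurable borel" and "s > 0"
  shows "(\<integral>\<^sup>+x. g x \<partial>lborel) = ennreal (s ^ DIM('a)) * (\<integral>\<^sup>+x. g (t + s *\<^sub>R x) \<partial>lborel)"
  using assms(2)
  by (subst lborel_affine[where c=s and t=t])
    (auto simp: nn_integral_density nn_integral_distr nn_integral_cmult)

lemma nn_integral_lborel_translate:
  fixes g :: "'a::euclidean_space \<Rightarrow> ennreal"
  assumes "g \<in> borel_measurable borel"
  shows "(\<integral>\<^sup>+x. g (t + x) \<partial>lborel) = (\<integral>\<^sup>+x. g x \<partial>lborel)"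
  using nn_integral_lborel_scale[OF assms, of 1 t] by simp

lemma nn_integral_lborel_reflect:
  fixes g :: "'a::euclidean_space \<Rightarrow> ennreal"
  assumes [measurable]: "g \<in> borel_measurable borel"
  shows "(\<integral>\<^sup>+x. g (t - x) \<partial>lborel) = (\<integral>\<^sup>+x. g x \<partial>lborel)"
  by (subst (2) lborel_affine[where c="-1" and t=t])
    (auto simp: nn_integral_density nn_integral_distr nn_integral_cmult)

text \<open>Convolving with the indicator of a ball, which is rotation invariant, reduces the
  invariance of Lebesgue measure under orthogonal maps to its invariance under translations.\<close>
lemma nn_integral_lborel_orthogonal:
  fixes g :: "'a::euclidean_space \<Rightarrow> ennreal" and f :: "'a \<Rightarrow> 'a"
  assumes g[measurable]: "g \<in> borel_measurable borel" and f: "orthogonal_transformation f"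
  shows "(\<integral>\<^sup>+x. g (f x) \<partial>lborel) = (\<integral>\<^sup>+x. g x \<partial>lborel)"
proof -
  interpret f: linear f using f by (rule orthogonal_transformation_linear)
  have [measurable]: "f \<in> borel_measurable borel"
    by (intro borel_measurable_continuous_onI linear_continuous_on linear_linear[THEN iffD2] f.linear_axioms)
  define \<phi> :: "'a \<Rightarrow> ennreal" where "\<phi> = indicator (ball 0 1)"
  have [measurable]: "\<phi> \<in> borel_measurable borel" unfolding \<phi>_def by (intro borel_measurable_indicator) simp
  obtain h where h: "\<And>y. f (h y) = y" 
    using orthogonal_transformation_surj[OF f] by (metis surjD)
  have \<phi>f: "\<phi> (f x) = \<phi> x" for x
    by (simp add: \<phi>_def indicator_def orthogonal_transformation_norm[OF f])
  let ?V = "\<integral>\<^sup>+x. \<phi> x \<partial>(lborel::'a measure)"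
  have V: "?V = emeasure lborel (ball (0::'a) 1)" by (simp add: \<phi>_def)
  have "?V * (\<integral>\<^sup>+x. g (f x) \<partial>lborel) = (\<integral>\<^sup>+y. \<phi> y * (\<integral>\<^sup>+x. g (f x) \<partial>lborel) \<partial>lborel)"
    by (simp add: nn_integral_multc)
  also have "\<dots> = (\<integral>\<^sup>+y. (\<integral>\<^sup>+x. \<phi> y * g (f x + y) \<partial>lborel) \<partial>lborel)"
  proof (rule nn_integral_cong)
    fix y :: 'a
    have "(\<integral>\<^sup>+x. g (f x) \<partial>lborel) = (\<integral>\<^sup>+x. g (f (h y + x)) \<partial>lborel)"
      by (rule nn_integral_lborel_translate[symmetric]) measurable
    also have "\<dots> = (\<integral>\<^sup>+x. g (f x + y) \<partial>lborel)" by (simp add: f.add h add.commute)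
    finally show "\<phi> y * (\<integral>\<^sup>+x. g (f x) \<partial>lborel) = (\<integral>\<^sup>+x. \<phi> y * g (f x + y) \<partial>lborel)"
      by (simp add: nn_integral_cmult)
  qed
  also have "\<dots> = (\<integral>\<^sup>+x. (\<integral>\<^sup>+y. \<phi> y * g (f x + y) \<partial>lborel) \<partial>lborel)"
    by (rule lborel_pair.Fubini') measurable
  also have "\<dots> = (\<integral>\<^sup>+x. (\<integral>\<^sup>+y. \<phi> (y - f x) * g y \<partial>lborel) \<partial>lborel)"
  proof (rule nn_integral_cong)
    fix x :: 'a
    have "(\<integral>\<^sup>+y. \<phi> (y - f x) * g y \<partial>lborel) = (\<integral>\<^sup>+y. \<phi> ((f x + y) - f x) * g (f x + y) \<partial>lborel)"
      by (rule nn_integral_lborel_translate[symmetric]) measurable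
    then show "(\<integral>\<^sup>+y. \<phi> y * g (f x + y) \<partial>lborel) = (\<integral>\<^sup>+y. \<phi> (y - f x) * g y \<partial>lborel)" by simp
  qed
  also have "\<dots> = (\<integral>\<^sup>+y. (\<integral>\<^sup>+x. \<phi> (y - f x) * g y \<partial>lborel) \<partial>lborel)"
    by (rule lborel_pair.Fubini') measurable
  also have "\<dots> = (\<integral>\<^sup>+y. ?V * g y \<partial>lborel)"
  proof (rule nn_integral_cong)
    fix y :: 'a
    have "(\<integral>\<^sup>+x. \<phi> (y - f x) \<partial>lborel) = (\<integral>\<^sup>+x. \<phi> (h y - x) \<partial>lborel)"
      by (rule nn_integral_cong) (metis \<phi>f f.diff h)
    also have "\<dots> = ?V" by (rule nn_integral_lborel_reflect) measurable
    finally show "(\<integral>\<^sup>+x. \<phi> (y - f x) * g y \<partial>lborel) = ?V * g y"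
      by (simp add: nn_integral_multc)
  qed
  also have "\<dots> = ?V * (\<integral>\<^sup>+y. g y \<partial>lborel)" by (simp add: nn_integral_cmult)
  finally have *: "?V * (\<integral>\<^sup>+x. g (f x) \<partial>lborel) = ?V * (\<integral>\<^sup>+y. g y \<partial>lborel)" .
  have "?V \<noteq> \<infinity>" using emeasure_lborel_ball_finite[of "0::'a" 1] unfolding V by simp
  moreover have "?V \<noteq> 0"
    using content_ball_pos[of 1 "0::'a"] unfolding V by (auto simp: measure_def)
  ultimately show ?thesis using * by (simp add: ennreal_mult_cancel_left)
qed

section \<open>Mean value properties\<close>

text \<open>Complex linearity of the real derivative encodes the Cauchy-Riemann equations.
  \<open>holo_ball\<close> is this property at every point of the ball; the pointwise form passes
  easily through affine changes of variable.\<close>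

definition complex_differentiable :: "(complex ^ 'n \<Rightarrow> complex) \<Rightarrow> complex ^ 'n \<Rightarrow> bool" where
  "complex_differentiable f z \<longleftrightarrow>
     (\<exists>D. (f has_derivative D) (at z) \<and> (\<forall>c v. D (c *s v) = c * D v))"

section \<open>Calculus of complex differentiable functions\<close>

lemma norm_smult_vec: "norm (c *s w) = cmod c * norm (w :: complex ^ 'n)"
  by (simp add: norm_vec_def norm_mult L2_set_right_distrib)

lemma scaleR_smult_vec: "r *\<^sub>R (w :: complex ^ 'n) = of_real r *s w"
  by (simp add: vec_eq_iff scaleR_conv_of_real[symmetric])

lemma bounded_linear_smult_left: "bounded_linear (\<lambda>c. c *s (w :: complex ^ 'n))"
  by (rule bounded_linear_intro[where K="norm w"])
    (simp_all add: norm_smult_vec vector_sadd_rdistrib scaleR_smult_vec vector_smult_assoc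
      scaleR_conv_of_real)

lemma continuous_on_smult_vec [continuous_intros]:
  fixes g :: "'a::topological_space \<Rightarrow> complex ^ 'n"
  assumes "continuous_on S f" "continuous_on S g"
  shows "continuous_on S (\<lambda>x. f x *s g x)"
  unfolding vector_scalar_mult_def using assms by (intro continuous_intros)

lemma complex_differentiable_imp_isCont: "complex_differentiable f z \<Longrightarrow> isCont f z"
  unfolding complex_differentiable_def using has_derivative_continuous by blast

lemma complex_differentiable_imp_continuous_on:
  "(\<And>z. z \<in> S \<Longrightarrow> complex_differentiable f z) \<Longrightarrow> continuous_on S f"
  using complex_differentiable_imp_isCont by (blast intro: continuous_at_imp_continuous_on)

lemma complex_differentiable_compose_affine:
  assumes g: "complex_differentiable g (c + T w)"
    and T: "bounded_linear T" "\<And>a v. T (a *s v) = a *s T v"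
  shows "complex_differentiable (\<lambda>w. g (c + T w)) w"
proof -
  obtain D where D: "(g has_derivative D) (at (c + T w))" "\<And>a v. D (a *s v) = a * D v"
    using g unfolding complex_differentiable_def by blast
  have "((\<lambda>w. c + T w) has_derivative T) (at w)"
    using bounded_linear_imp_has_derivative[OF T(1)] by (auto intro!: derivative_eq_intros)
  then have "((\<lambda>w. g (c + T w)) has_derivative (\<lambda>w. D (T w))) (at w)"
    using D(1) by (rule has_derivative_compose)
  then show ?thesis unfolding complex_differentiable_def
    by (auto simp: D(2) T(2))
qed

lemma complex_differentiable_slice:
  assumes "complex_differentiable g (c + \<zeta> *s w)"
  shows "(\<lambda>\<zeta>. g (c + \<zeta> *s w)) field_differentiable (at \<zeta>)"
proof -
  obtain D where D: "(g has_derivative D) (at (c + \<zeta> *s w))" "\<And>a v. D (a *s v) = a * D v"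
    using assms unfolding complex_differentiable_def by blast
  have "((\<lambda>\<zeta>. c + \<zeta> *s w) has_derivative (\<lambda>\<eta>. \<eta> *s w)) (at \<zeta>)"
    using bounded_linear_imp_has_derivative[OF bounded_linear_smult_left] 
    by (auto intro!: derivative_eq_intros)
  then have "((\<lambda>\<zeta>. g (c + \<zeta> *s w)) has_derivative (\<lambda>\<eta>. D (\<eta> *s w))) (at \<zeta>)"
    using D(1) by (rule has_derivative_compose)
  then have "((\<lambda>\<zeta>. g (c + \<zeta> *s w)) has_field_derivative D w) (at \<zeta>)"
    by (simp add: has_field_derivative_def D(2) mult.commute[of _ "D w"])
  then show ?thesis unfolding field_differentiable_def by blast
qed

text \<open>Cauchy's formula at the centre of the unit circle; the parametrisation over
  \<open>{0..1}\<close> has total mass 1, so no normalising factor appears.\<close>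

lemma cmod_le_circle_mean:
  assumes "h holomorphic_on S" "cball 0 1 \<subseteq> S"
  shows "ennreal (cmod (h 0)) \<le>
    (\<integral>\<^sup>+t. indicator {0..1} t * ennreal (cmod (h (exp (2 * of_real pi * \<i> * of_real t)))) \<partial>lborel)"
proof -
  define e where "e = (\<lambda>t. exp (2 * of_real pi * \<i> * of_real t) :: complex)"
  have e: "cmod (e t) = 1" "e t \<noteq> 0" for t by (simp_all add: e_def)
  have h: "h holomorphic_on cball 0 1" using assms holomorphic_on_subset by blast
  have cont: "continuous_on {0..1} (\<lambda>t. h (e t))"
    using holomorphic_on_imp_continuous_on[OF h]
    by (rule continuous_on_compose2[where t="cball 0 1"]) (auto simp: e, auto simp: e_def intro!: continuous_intros)
  have "((\<lambda>u. h u / (u - 0)) has_contour_integral (2 * of_real pi * \<i> * h 0)) (circlepath 0 1)"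
    using h by (intro Cauchy_integral_circlepath_simple) auto
  then have "((\<lambda>t. h (circlepath 0 1 t) / circlepath 0 1 t *
      vector_derivative (circlepath 0 1) (at t within {0..1})) has_integral 2 * of_real pi * \<i> * h 0) {0..1}"
    by (simp add: has_contour_integral_def)
  then have "((\<lambda>t. (2 * of_real pi * \<i>) * h (e t)) has_integral 2 * of_real pi * \<i> * h 0) {0..1}"
    by (rule has_integral_eq[rotated]) 
      (use e in \<open>simp add: vector_derivative_circlepath01, simp add: circlepath e_def\<close>)
  from has_integral_mult_right[OF this, of "inverse (2 * of_real pi * \<i>)"]
  have I: "((\<lambda>t. h (e t)) has_integral h 0) {0..1}"
    by (simp add: field_simps)
  have int: "(\<lambda>t. cmod (h (e t))) integrable_on {0..1}"
    using cont by (intro integrable_continuous_real continuous_intros)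
  have "cmod (h 0) \<le> integral {0..1} (\<lambda>t. cmod (h (e t)))"
    using integral_norm_bound_integral[OF has_integral_integrable[OF I] int] integral_unique[OF I]
    by simp
  then have "ennreal (cmod (h 0)) \<le> ennreal (integral {0..1} (\<lambda>t. cmod (h (e t))))"
    by (rule ennreal_leI)
  also have "\<dots> = (\<integral>\<^sup>+t. indicator {0..1} t * cmod (h (e t)) \<partial>lborel)"
    using nn_integral_has_integral_lebesgue[OF _ integrable_integral[OF int]] by simp
  also have "\<dots> = (\<integral>\<^sup>+t. indicator {0..1} t * ennreal (cmod (h (e t))) \<partial>lborel)"
    by (intro nn_integral_cong) (simp add: indicator_def)
  finally show ?thesis by (simp add: e_def)
qed

lemma borel_measurable_indicator_continuous_on:
  fixes f :: "'a::euclidean_space \<Rightarrow> real"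
  assumes "S \<in> sets borel" "continuous_on S f"
  shows "(\<lambda>x. indicator S x * ennreal (f x)) \<in> borel_measurable borel"
proof -
  have "(\<lambda>x. ennreal (indicator S x *\<^sub>R f x)) \<in> borel_measurable borel"
    using borel_measurable_continuous_on_indicator[OF assms] by measurable
  also have "(\<lambda>x. ennreal (indicator S x *\<^sub>R f x)) = (\<lambda>x. indicator S x * ennreal (f x))"
    by (auto simp: indicator_def)
  finally show ?thesis .
qed

text \<open>Rotating the ball by unimodular scalars reduces the claim to the mean value property on
  the complex lines through the centre.\<close>
lemma cmod_le_ball_mean:
  fixes g :: "complex ^ 'n \<Rightarrow> complex"
  assumes g: "\<And>z. z \<in> ball c r \<Longrightarrow> complex_differentiable g z"
  shows "ennreal (cmod (g c)) * emeasure lborel (ball c r) \<le>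
    (\<integral>\<^sup>+w. indicator (ball c r) w * ennreal (cmod (g w)) \<partial>lborel)"
proof -
  define e where "e = (\<lambda>t. exp (2 * of_real pi * \<i> * of_real t) :: complex)"
  have e: "cmod (e t) = 1" for t by (simp add: e_def)
  have contg: "continuous_on (ball c r) g"
    using g by (rule complex_differentiable_imp_continuous_on)
  define G where "G = (\<lambda>w. indicator (ball c r) w * ennreal (cmod (g w)))"
  have G[measurable]: "G \<in> borel_measurable borel"
    unfolding G_def using contg
    by (intro borel_measurable_indicator_continuous_on continuous_intros) auto
  have rot: "orthogonal_transformation (\<lambda>w::complex^'n. e t *s w)" for t
    unfolding orthogonal_transformation
    by (auto simp: norm_smult_vec e vector_add_ldistrib scaleR_smult_vec vector_smult_assoc
        mult.commute intro!: linearI)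
  have "(\<lambda>p. e (snd p) *s fst p) \<in> borel_measurable (borel :: ((complex^'n) \<times> real) measure)"
    unfolding e_def by (intro borel_measurable_continuous_onI continuous_intros)
  then have [measurable]: "(\<lambda>p. e (snd p) *s fst p) \<in> borel_measurable ((borel :: (complex^'n) measure) \<Otimes>\<^sub>M (borel :: real measure))"
    by (simp add: borel_prod)
  have rotG: "(\<integral>\<^sup>+w. G (c + e t *s w) \<partial>lborel) = (\<integral>\<^sup>+w. G w \<partial>lborel)" for t
  proof -
    have "(\<integral>\<^sup>+w. G (c + e t *s w) \<partial>lborel) = (\<integral>\<^sup>+w. G (c + w) \<partial>lborel)"
      using nn_integral_lborel_orthogonal[OF _ rot, of "\<lambda>w. G (c + w)"] by simp
    then show ?thesis by (simp add: nn_integral_lborel_translate)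
  qed
  have ind: "indicator (ball c r) (c + w) = (indicator (ball 0 r) w :: ennreal)" for w :: "complex^'n"
    by (simp add: indicator_def dist_norm)
  have [measurable]: "ball 0 r \<in> sets (borel :: (complex^'n) measure)" by simp
  have "emeasure lborel (ball c r) = (\<integral>\<^sup>+w. indicator (ball 0 r) w \<partial>(lborel :: (complex^'n) measure))"
    using nn_integral_lborel_translate[of "indicator (ball c r)" c] unfolding ind
    by (simp add: borel_measurable_indicator)
  then have "ennreal (cmod (g c)) * emeasure lborel (ball c r) =
      (\<integral>\<^sup>+w. ennreal (cmod (g c)) * indicator (ball c r) (c + w) \<partial>lborel)"
    unfolding ind by (simp add: nn_integral_cmult)
  also have "\<dots> \<le> (\<integral>\<^sup>+w. (\<integral>\<^sup>+t. indicator {0..1::real} t * G (c + e t *s w) \<partial>lborel) \<partial>lborel)"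
  proof (rule nn_integral_mono)
    fix w :: "complex^'n"
    show "ennreal (cmod (g c)) * indicator (ball c r) (c + w) \<le>
      (\<integral>\<^sup>+t. indicator {0..1} t * G (c + e t *s w) \<partial>lborel)"
    proof (cases "norm w < r")
      case True
      define S where "S = {\<zeta>. c + \<zeta> *s w \<in> ball c r}"
      have S: "\<zeta> \<in> S \<longleftrightarrow> cmod \<zeta> * norm w < r" for \<zeta>
        by (simp add: S_def dist_norm norm_smult_vec)
      have "ennreal (cmod (g (c + 0 *s w))) \<le>
          (\<integral>\<^sup>+t. indicator {0..1} t * ennreal (cmod (g (c + e t *s w))) \<partial>lborel)"
        unfolding e_def
      proof (rule cmod_le_circle_mean)
        show "(\<lambda>\<zeta>. g (c + \<zeta> *s w)) holomorphic_on S" unfolding holomorphic_on_def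
          by (auto simp: S_def intro!: field_differentiable_at_within complex_differentiable_slice g)
        show "cball 0 1 \<subseteq> S"
          using True by (auto simp: S) (meson le_less_trans mult_left_le_one_le norm_ge_zero)
      qed
      also have "\<dots> = (\<integral>\<^sup>+t. indicator {0..1} t * G (c + e t *s w) \<partial>lborel)"
        using True by (intro nn_integral_cong) (simp add: G_def dist_norm norm_smult_vec e)
      finally show ?thesis using True by (simp add: dist_norm)
    qed (simp add: dist_norm)
  qed
  also have "\<dots> = (\<integral>\<^sup>+t. (\<integral>\<^sup>+w. indicator {0..1::real} t * G (c + e t *s w) \<partial>lborel) \<partial>lborel)"
    by (rule lborel_pair.Fubini'[symmetric]) measurable
  also have "\<dots> = (\<integral>\<^sup>+t. indicator {0..1::real} t * (\<integral>\<^sup>+w. G w \<partial>lborel) \<partial>lborel)"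
    by (intro nn_integral_cong) (auto simp: rotG indicator_def)
  also have "\<dots> = (\<integral>\<^sup>+w. G w \<partial>lborel)"
    by (simp add: nn_integral_multc)
  finally show ?thesis by (simp add: G_def)
qed

text \<open>The common ground of the two classes. One constant \<open>A\<close> serves both power
  bounds, \<open>p > 0\<close> makes modulars small when the argument is divided by a large number,
  and \<open>surj\<close> makes \<open>ginv\<close> a right inverse.\<close>

locale growth_type =
  fixes \<Phi> :: "real \<Rightarrow> real" and p q A :: real
  assumes cont: "continuous_on {0..} \<Phi>"
    and mono: "\<And>x y. 0 \<le> x \<Longrightarrow> x \<le> y \<Longrightarrow> \<Phi> x \<le> \<Phi> y"
    and zero: "\<Phi> 0 = 0"
    and pos: "\<And>x. 0 < x \<Longrightarrow> 0 < \<Phi> x"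
    and surj: "\<Phi> ` {0..} = {0..}"
    and p: "0 < p" and A: "1 \<le> A"
    and lower: "\<And>s t. 0 \<le> s \<Longrightarrow> 0 < t \<Longrightarrow> t \<le> 1 \<Longrightarrow> \<Phi> (s * t) \<le> A * t powr p * \<Phi> s"
    and upper: "\<And>s t. 0 \<le> s \<Longrightarrow> 1 \<le> t \<Longrightarrow> \<Phi> (s * t) \<le> A * t powr q * \<Phi> s"
begin

lemma nonneg: "0 \<le> x \<Longrightarrow> 0 \<le> \<Phi> x"
  using mono[of 0 x] by (simp add: zero)

lemma continuous_on_norm_compose:
  "continuous_on S f \<Longrightarrow> continuous_on S (\<lambda>x. \<Phi> (norm (f x)))"
  by (rule continuous_on_compose2[OF cont]) (auto intro: continuous_intros)

text \<open>Let \<open>z0\<close> maximise \<open>(1 - \<bar>w\<bar>)\<^sup>d\<^sup>/\<^sup>p \<bar>g w\<bar>\<close>. On the ball of radius \<open>(1 - \<bar>z0\<bar>) / 2\<close> about \<open>z0\<close> the values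
  of \<open>\<bar>g\<bar>\<close> are at most a constant times \<open>M = \<bar>g z0\<bar>\<close>, so a mean of \<open>\<bar>g\<bar>\<close> of at least \<open>M\<close> forces a
  mean of \<open>\<Phi> (\<bar>g\<bar>)\<close> comparable to \<open>\<Phi> M\<close>. This replaces the subharmonicity of \<open>\<bar>g\<bar>\<^sup>p\<close>.\<close>
lemma weak_mean_value:
  obtains C where "C > 0"
    "\<And>g :: complex ^ 'n \<Rightarrow> complex. (\<And>z. z \<in> ball 0 1 \<Longrightarrow> complex_differentiable g z) \<Longrightarrow>
       continuous_on (cball 0 1) g \<Longrightarrow>
       ennreal (\<Phi> (cmod (g 0))) \<le>
         ennreal C * (\<integral>\<^sup>+w. indicator (ball 0 1) w * ennreal (\<Phi> (cmod (g w))) \<partial>lborel)"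
proof -
  define d where "d = DIM(complex ^ 'n)"
  \<comment> \<open>Chosen so that \<open>(\<sigma> powr a) powr p = \<sigma> ^ d\<close>, the order
    of the volume of a ball of radius \<open>\<sigma> / 2\<close>: the loss in comparing the centre
    with \<open>z0\<close> then cancels the volume factor.\<close>
  define a where "a = real d / p"
  define K :: real where "K = 2 powr a"
  define V where "V = measure lborel (ball (0 :: complex ^ 'n) 1)"
  define C where "C = A * A * 2 powr q * 2 ^ d * 2 * K / V"
  have V: "V > 0" unfolding V_def by (rule content_ball_pos) simp
  have "d > 0" unfolding d_def by (rule DIM_positive)
  then have a: "a > 0" using p by (simp add: a_def)
  have K: "K \<ge> 1" using a by (simp add: K_def ge_one_powr_ge_zero)
  have C: "C > 0" using A V K by (simp add: C_def)
  have "ennreal (\<Phi> (cmod (g 0))) \<le>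
         ennreal C * (\<integral>\<^sup>+w. indicator (ball 0 1) w * ennreal (\<Phi> (cmod (g w))) \<partial>lborel)"
    if diff: "\<And>z. z \<in> ball 0 1 \<Longrightarrow> complex_differentiable g z"
      and cg: "continuous_on (cball 0 1) g" for g :: "complex ^ 'n \<Rightarrow> complex"
  \<comment> \<open>Once \<open>g 0 = 0\<close> is excluded, the weighted maximum is positive, so
    that \<open>z0\<close> lies strictly inside the ball and \<open>M > 0\<close>.\<close>
  proof (cases "g 0 = 0 \<or> (\<integral>\<^sup>+w. indicator (ball 0 1) w * ennreal (\<Phi> (cmod (g w))) \<partial>lborel) = \<infinity>")
    case True
    then show ?thesis using C by (auto simp: zero ennreal_mult_top)
  next
    case False
    define I where "I = (\<integral>\<^sup>+w. indicator (ball 0 1) w * ennreal (\<Phi> (cmod (g w))) \<partial>lborel)"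
    define J where "J = enn2real I"
    have I: "I = ennreal J" "J \<ge> 0" using False by (auto simp: I_def J_def less_top)
    define F where "F = (\<lambda>w. (1 - norm w) powr a * cmod (g w))"
    have "continuous_on (cball 0 1) F" unfolding F_def
      using a by (intro continuous_intros continuous_on_powr' cg) auto
    then obtain z0 where z0: "z0 \<in> cball 0 1" and max: "\<And>w. w \<in> cball 0 1 \<Longrightarrow> F w \<le> F z0"
      using continuous_attains_sup[of "cball (0 :: complex ^ 'n) 1" F] by auto
    define \<sigma> M where "\<sigma> = 1 - norm z0" and "M = cmod (g z0)"
    have g0: "cmod (g 0) \<le> \<sigma> powr a * M"
      using max[of 0] by (simp add: F_def \<sigma>_def M_def)
    have "\<sigma> \<noteq> 0" "M \<noteq> 0" using g0 False by auto
    then have \<sigma>: "0 < \<sigma>" "\<sigma> \<le> 1" and M: "0 < M" using z0 by (auto simp: \<sigma>_def M_def)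
    define \<rho> where "\<rho> = \<sigma> / 2"
    have sub: "ball z0 \<rho> \<subseteq> ball 0 1" 
      using \<sigma> by (auto simp: ball_subset_ball_iff dist_norm \<rho>_def \<sigma>_def field_simps)
    have bound: "cmod (g w) \<le> K * M" if w: "w \<in> ball z0 \<rho>" for w
    proof -
      have "norm w < norm z0 + \<rho>" using w norm_triangle_ineq2[of w z0]
        by (simp add: dist_norm norm_minus_commute)
      then have "\<sigma> / 2 \<le> 1 - norm w" by (simp add: \<rho>_def \<sigma>_def field_simps)
      then have "(\<sigma> / 2) powr a * cmod (g w) \<le> F w" unfolding F_def
        using \<sigma> a by (intro mult_right_mono powr_mono2) auto
      also have "\<dots> \<le> \<sigma> powr a * M"
        using max[of w] sub w by (auto simp: F_def \<sigma>_def M_def)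
      finally show ?thesis using \<sigma> by (simp add: powr_divide K_def field_simps)
    qed
    define b where "b = M * K / \<Phi> (M / 2)"
    have \<Phi>M: "\<Phi> (M / 2) > 0" using M by (intro pos) auto
    have b: "b \<ge> 0" using M K \<Phi>M by (simp add: b_def)
    \<comment> \<open>Values up to \<open>M / 2\<close> are covered by the first term; for larger
      ones \<open>\<Phi> (cmod (g w)) \<ge> \<Phi> (M / 2)\<close> while
      \<open>cmod (g w) \<le> K * M\<close>. After integration the \<open>M / 2\<close> part is
      absorbed into the left side.\<close>
    have lin: "cmod (g w) \<le> M / 2 + b * \<Phi> (cmod (g w))" if w: "w \<in> ball z0 \<rho>" for w
    proof (cases "cmod (g w) \<le> M / 2")
      case True
      then show ?thesis using b nonneg[of "cmod (g w)"] by (simp add: add_increasing2)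
    next
      case False
      then have "M * K * \<Phi> (M / 2) \<le> M * K * \<Phi> (cmod (g w))"
        using M K by (intro mult_left_mono mono) auto
      then have "M * K \<le> b * \<Phi> (cmod (g w))" using \<Phi>M by (simp add: b_def field_simps)
      then show ?thesis using bound[OF w] M by (simp add: mult.commute)
    qed
    have contg: "continuous_on (ball z0 \<rho>) g"
      using sub by (intro complex_differentiable_imp_continuous_on diff) auto
    have [measurable]: "(\<lambda>w. indicator (ball z0 \<rho>) w * ennreal (\<Phi> (cmod (g w)))) \<in> borel_measurable borel"
      by (intro borel_measurable_indicator_continuous_on continuous_on_norm_compose contg) simp
    have [measurable]: "ball z0 \<rho> \<in> sets borel" by simp
    define V' where "V' = measure lborel (ball z0 \<rho>)"
    have V': "V' = \<rho> ^ d * V" unfolding V'_def V_def d_def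
      using \<sigma> by (intro content_ball_conv_unit_ball) (simp add: \<rho>_def)
    have eV': "emeasure lborel (ball z0 \<rho>) = ennreal V'"
      using emeasure_lborel_ball_finite[of z0 \<rho>] unfolding V'_def
      by (intro emeasure_eq_ennreal_measure) auto
    have "ennreal (M * V') = ennreal (cmod (g z0)) * emeasure lborel (ball z0 \<rho>)"
      unfolding eV' M_def by (simp add: ennreal_mult V'_def)
    also have "\<dots> \<le> (\<integral>\<^sup>+w. indicator (ball z0 \<rho>) w * ennreal (cmod (g w)) \<partial>lborel)"
      using sub by (intro cmod_le_ball_mean diff) auto
    also have "\<dots> \<le> (\<integral>\<^sup>+w. ennreal (M / 2) * indicator (ball z0 \<rho>) w +
        ennreal b * (indicator (ball z0 \<rho>) w * ennreal (\<Phi> (cmod (g w)))) \<partial>lborel)"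
    proof (rule nn_integral_mono)
      fix w
      show "indicator (ball z0 \<rho>) w * ennreal (cmod (g w)) \<le> ennreal (M / 2) * indicator (ball z0 \<rho>) w +
        ennreal b * (indicator (ball z0 \<rho>) w * ennreal (\<Phi> (cmod (g w))))"
        using lin[of w] M b nonneg[of "cmod (g w)"]
        by (cases "w \<in> ball z0 \<rho>") 
          (auto simp: ennreal_mult[symmetric] ennreal_plus[symmetric] simp del: ennreal_plus intro!: ennreal_leI)
    qed
    also have "\<dots> = ennreal (M / 2) * ennreal V' +
        ennreal b * (\<integral>\<^sup>+w. indicator (ball z0 \<rho>) w * ennreal (\<Phi> (cmod (g w))) \<partial>lborel)"
      by (simp add: nn_integral_add nn_integral_cmult eV')
    also have "\<dots> \<le> ennreal (M / 2) * ennreal V' + ennreal b * I"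
      unfolding I_def using sub
      by (intro add_left_mono mult_left_mono nn_integral_mono) (auto simp: indicator_def)
    also have "\<dots> = ennreal (M / 2 * V' + b * J)"
      using M b I(2) unfolding I(1)
      by (simp add: ennreal_mult[symmetric] ennreal_plus[symmetric] V'_def del: ennreal_plus)
    finally have "M * V' \<le> M / 2 * V' + b * J"
      using M b I by (subst (asm) ennreal_le_iff) (auto simp: V'_def)
    then have "M * (V' * \<Phi> (M / 2)) \<le> M * (2 * K * J)"
      using \<Phi>M by (simp add: b_def field_simps)
    then have key: "\<rho> ^ d * V * \<Phi> (M / 2) \<le> 2 * K * J"
      using M by (simp add: V')
    have "\<Phi> (cmod (g 0)) \<le> \<Phi> (M * \<sigma> powr a)"
      using g0 by (intro mono) (auto simp: mult.commute)
    also have "\<dots> \<le> A * (\<sigma> powr a) powr p * \<Phi> M"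
      using M \<sigma> a by (intro lower powr_le1) auto
    also have "(\<sigma> powr a) powr p = \<sigma> ^ d"
      using \<sigma> p by (simp add: powr_powr a_def powr_realpow)
    also have "\<Phi> M \<le> A * 2 powr q * \<Phi> (M / 2)"
      using upper[of "M / 2" 2] M by simp
    finally have "\<Phi> (cmod (g 0)) \<le> A * \<sigma> ^ d * (A * 2 powr q * \<Phi> (M / 2))"
      using A \<sigma> by (simp add: mult_left_mono)
    also have "\<dots> = A * A * 2 powr q * 2 ^ d / V * (\<rho> ^ d * V * \<Phi> (M / 2))"
      using V by (simp add: \<rho>_def power_divide)
    also have "\<dots> \<le> A * A * 2 powr q * 2 ^ d / V * (2 * K * J)"
      using key A V by (intro mult_left_mono) auto
    also have "\<dots> = C * J" by (simp add: C_def)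
    finally show ?thesis unfolding I_def[symmetric] I(1)
      using C I(2) by (simp add: ennreal_mult[symmetric] ennreal_leI)
  qed
  with C show ?thesis by (rule that)
qed

end

section \<open>Pointwise bounds\<close>

lemma Basis_vec_eq_image: "(Basis :: ('a::euclidean_space ^ 'n) set) = (\<lambda>(i, u). axis i u) ` (UNIV \<times> Basis)"
  by (auto simp: Basis_vec_def)

text \<open>Scaling one coordinate by \<open>l i\<close> stretches all of its real directions, so a
  complex coordinate contributes its factor twice.\<close>

lemma nn_integral_lborel_diagonal_vec:
  fixes g :: "'a::euclidean_space ^ 'n \<Rightarrow> ennreal" and l :: "'n \<Rightarrow> real"
  assumes "g \<in> borel_measurable borel" and l: "\<And>i. l i > 0"
  shows "(\<integral>\<^sup>+x. g x \<partial>lborel) =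
    ennreal (\<Prod>i\<in>UNIV. l i ^ DIM('a)) * (\<integral>\<^sup>+x. g (t + (\<chi> i. l i *\<^sub>R x $ i)) \<partial>lborel)"
proof -
  define S where "S = (\<lambda>x :: 'a ^ 'n. \<chi> i. l i *\<^sub>R x $ i)"
  have S_axis: "S (axis i u) = l i *\<^sub>R axis i u" for i u
    by (simp add: S_def vec_eq_iff axis_def)
  have c: "S (axis i u) \<bullet> axis i u = l i" if "u \<in> Basis" for i u
    using that by (simp add: S_axis inner_axis_axis)
  have S_eq: "(\<Sum>j\<in>Basis. ((S j \<bullet> j) * (x \<bullet> j)) *\<^sub>R j) = S x" for x
  proof (rule euclidean_eqI)
    fix b :: "'a ^ 'n" assume b: "b \<in> Basis"
    then obtain i u where u: "b = axis i u" "u \<in> Basis" by (auto simp: Basis_vec_def)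
    have "(\<Sum>j\<in>Basis. ((S j \<bullet> j) * (x \<bullet> j)) *\<^sub>R j) \<bullet> b = (S b \<bullet> b) * (x \<bullet> b)"
      using b by (simp add: inner_sum_left inner_Basis if_distrib cong: if_cong)
    also have "\<dots> = S x \<bullet> b" unfolding u c[OF u(2)]
      by (simp add: inner_axis S_def)
    finally show "(\<Sum>j\<in>Basis. ((S j \<bullet> j) * (x \<bullet> j)) *\<^sub>R j) \<bullet> b = S x \<bullet> b" .
  qed
  have "(\<Prod>j\<in>Basis. \<bar>S j \<bullet> j\<bar>) = (\<Prod>(i, u)\<in>UNIV \<times> Basis. \<bar>S (axis i u) \<bullet> axis i u\<bar>)"
    unfolding Basis_vec_eq_image
    by (subst prod.reindex) (auto simp: inj_on_def axis_eq_axis case_prod_unfold)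
  also have "\<dots> = (\<Prod>(i, u)\<in>UNIV \<times> (Basis :: 'a set). l i)"
    using l by (intro prod.cong) (auto simp: c less_imp_le)
  also have "\<dots> = (\<Prod>i\<in>UNIV. l i ^ DIM('a))"
    by (subst prod.cartesian_product[symmetric]) simp
  finally have prod: "(\<Prod>j\<in>Basis. \<bar>S j \<bullet> j\<bar>) = (\<Prod>i\<in>UNIV. l i ^ DIM('a))" .
  have "S j \<bullet> j \<noteq> 0" if "j \<in> Basis" for j
    using that l by (auto simp: Basis_vec_def c) (metis less_irrefl)
  from nn_integral_lborel_diagonal[of g "\<lambda>j. S j \<bullet> j" t, OF assms(1) this]
  show ?thesis unfolding prod S_eq by (simp add: S_def)
qed

text \<open>\<open>T\<close> is a complex Householder reflection followed by a change of phase.\<close>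
lemma exists_unitary_axis:
  fixes z :: "complex ^ 'n" and k :: 'n
  obtains T where "orthogonal_transformation T" "\<And>a v. T (a *s v) = a *s T v"
    "T (axis k (of_real (norm z))) = z"
proof -
  define x where "x = sgn z"
  \<comment> \<open>A complex reflection can exchange two unit vectors only if their Hermitian
    product is real; removing the phase of \<open>x $ k\<close> makes the product of
    \<open>e\<close> and \<open>y\<close> real.\<close>
  define \<omega> where "\<omega> = (if x $ k = 0 then 1 else sgn (x $ k))"
  have \<omega>: "cmod \<omega> = 1" "\<omega> * cnj \<omega> = 1"
    by (simp_all add: \<omega>_def norm_sgn complex_norm_square[symmetric])
  have xk: "cnj \<omega> * x $ k = of_real (cmod (x $ k))"
    by (simp add: \<omega>_def sgn_eq complex_norm_square[symmetric] power2_eq_square field_simps)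
  define y where "y = cnj \<omega> *s x"
  define h where "h = (\<lambda>u w :: complex ^ 'n. \<Sum>i\<in>UNIV. u $ i * cnj (w $ i))"
  define e where "e = (axis k 1 :: complex ^ 'n)"
  define v where "v = e - y"
  define U where "U = (\<lambda>w. w - (2 * h w v / of_real ((norm v)\<^sup>2)) *s v)"
  define T where "T = (\<lambda>w. \<omega> *s U w)"
  have h_add: "h (u + u') w = h u w + h u' w" for u u' w
    by (simp add: h_def sum.distrib algebra_simps)
  have h_smult: "h (a *s u) w = a * h u w" for a u w
    by (simp add: h_def sum_distrib_left mult.assoc)
  have inner_smult: "w \<bullet> (a *s u) = Re (cnj a * h w u)" for w a u
    by (simp add: inner_vec_def h_def inner_complex_def sum_distrib_left algebra_simps sum.distrib)
  have U_smult: "U (a *s w) = a *s U w" for a w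
    by (simp add: U_def h_smult vec_eq_iff algebra_simps)
  have U_add: "U (w + w') = U w + U w'" for w w'
    by (simp add: U_def h_add vec_eq_iff algebra_simps add_divide_distrib)
  have normU: "norm (U w) = norm w" for w
  proof (cases "v = 0")
    case False
    define a where "a = 2 * h w v / of_real ((norm v)\<^sup>2)"
    have "w \<bullet> (a *s v) = 2 * (cmod (h w v))\<^sup>2 / (norm v)\<^sup>2"
      unfolding inner_smult a_def
      by (simp add: complex_norm_square[symmetric] mult.commute[of "cnj _"] mult.assoc flip: of_real_power)
    moreover have "(norm (a *s v))\<^sup>2 = 4 * (cmod (h w v))\<^sup>2 / (norm v)\<^sup>2"
      using False by (simp add: norm_smult_vec a_def norm_mult norm_divide power_mult_distrib power_divide field_simps
          norm_power power2_eq_square)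
    moreover have "(norm (U w))\<^sup>2 = (norm w)\<^sup>2 - 2 * (w \<bullet> (a *s v)) + (norm (a *s v))\<^sup>2"
      unfolding U_def a_def[symmetric] by (simp add: power2_norm_eq_inner inner_diff_left inner_diff_right inner_commute)
    ultimately have "(norm (U w))\<^sup>2 = (norm w)\<^sup>2" by simp
    then show ?thesis by simp
  qed (simp add: U_def)
  have "linear T" 
    by (rule linearI) (simp_all add: T_def U_add U_smult scaleR_smult_vec vector_add_ldistrib vector_smult_assoc mult.commute)
  then have orth: "orthogonal_transformation T"
    unfolding orthogonal_transformation by (simp add: T_def norm_smult_vec normU \<omega>)
  have smult: "T (a *s w) = a *s T w" for a w
    by (simp add: T_def U_smult vector_smult_assoc mult.commute)
  have Te: "T e = x" if "z \<noteq> 0"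
  proof -
    have ny: "norm y = 1" using that by (simp add: y_def norm_smult_vec \<omega> x_def norm_sgn)
    have ne: "norm e = 1" by (simp add: e_def norm_eq_1 inner_axis_axis)
    have yk: "y $ k = of_real (cmod (x $ k))" by (simp add: y_def xk)
    have hev: "h e v = cnj (v $ k)"
      by (simp add: h_def e_def axis_def if_distrib[of "\<lambda>c. c * _"] cong: if_cong)
    have "(norm v)\<^sup>2 = (norm e)\<^sup>2 - 2 * (y \<bullet> e) + (norm y)\<^sup>2"
      by (simp add: v_def power2_norm_eq_inner inner_diff_left inner_diff_right inner_commute)
    also have "y \<bullet> e = cmod (x $ k)" by (simp add: e_def inner_axis yk inner_complex_def)
    finally have "(norm v)\<^sup>2 = 2 * (1 - cmod (x $ k))" by (simp add: ny ne)
    then have "2 * h e v = of_real ((norm v)\<^sup>2)"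
      unfolding hev by (simp add: v_def e_def yk)
    \<comment> \<open>If \<open>v = 0\<close> then \<open>e = y\<close> and \<open>U\<close> is the
      identity; otherwise the coefficient of \<open>v\<close> equals 1, so
      \<open>U e = e - v\<close>.\<close>
    then have "U e = y" by (cases "v = 0") (simp_all add: U_def, simp_all add: v_def)
    then show ?thesis by (simp add: T_def y_def vector_smult_assoc \<omega>)
  qed
  have "T (axis k (of_real (norm z))) = z"
  proof (cases "z = 0")
    case True
    have "axis k 0 = (0 :: complex ^ 'n)" by (simp add: vec_eq_iff axis_def)
    then have "T (axis k 0) = 0" using linear_0[OF \<open>linear T\<close>] by metis
    then show ?thesis using True by simp
  next
    case False
    have "axis k (of_real (norm z)) = of_real (norm z) *s e"
      by (simp add: e_def vec_eq_iff axis_def)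
    then have "T (axis k (of_real (norm z))) = norm z *\<^sub>R x"
      using Te[OF False] by (simp add: smult scaleR_smult_vec)
    then show ?thesis using False by (simp add: x_def sgn_div_norm)
  qed
  with orth smult show ?thesis by (rule that)
qed

lemma norm_vec_power2: "(norm (x :: 'a::real_normed_vector ^ 'n))\<^sup>2 = (\<Sum>i\<in>UNIV. (norm (x $ i))\<^sup>2)"
  by (simp add: norm_vec_def L2_set_def sum_nonneg)

text \<open>A displacement of order \<open>u\<close> in the complex normal direction changes
  \<open>(norm x)\<^sup>2\<close> by order \<open>u\<close>; a tangential one of order
  \<open>sqrt u\<close> enters only through its square, again of order \<open>u\<close>. The factors
  \<open>1 / 8\<close> leave room to stay inside the ball.\<close>

lemma nonisotropic_ellipsoid_bounds:
  fixes w :: "complex ^ 'n" and k :: 'n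
  assumes u: "0 < u" "u \<le> 1" and w: "norm w \<le> 1"
    and x: "x = axis k (of_real (1 - u)) + (\<chi> i. (if i = k then u / 8 else sqrt u / 8) *\<^sub>R w $ i)"
  shows "u / 2 \<le> 1 - (norm x)\<^sup>2" "1 - (norm x)\<^sup>2 \<le> 4 * u" "norm x < 1"
proof -
  have wi: "cmod (w $ i) \<le> 1" for i
    using Finite_Cartesian_Product.norm_nth_le[of w i] w by linarith
  have xk: "x $ k = of_real (1 - u) + of_real (u / 8) * w $ k"
    by (simp add: x scaleR_conv_of_real)
  have uw: "cmod (of_real (u / 8) * w $ k) \<le> u / 8"
    using u wi[of k] by (simp add: norm_mult mult_left_le)
  have r: "cmod (of_real (1 - u)) = 1 - u" using u by (simp only: norm_of_real)
  have xk_le: "cmod (x $ k) \<le> 1 - u + u / 8"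
    unfolding xk using norm_triangle_ineq[of "of_real (1 - u)" "of_real (u / 8) * w $ k"] uw r by linarith
  have xk_ge: "1 - u - u / 8 \<le> cmod (x $ k)"
    unfolding xk using norm_diff_ineq[of "of_real (1 - u)" "of_real (u / 8) * w $ k"] uw r by linarith
  have xi: "(cmod (x $ i))\<^sup>2 = u / 64 * (cmod (w $ i))\<^sup>2" if "i \<noteq> k" for i
    using that u by (simp add: x axis_def power_mult_distrib power_divide)
  have "(norm x)\<^sup>2 = (cmod (x $ k))\<^sup>2 + (\<Sum>i\<in>UNIV - {k}. u / 64 * (cmod (w $ i))\<^sup>2)"
    unfolding norm_vec_power2 by (subst sum.remove[of _ k]) (auto simp: xi)
  also have "(\<Sum>i\<in>UNIV - {k}. u / 64 * (cmod (w $ i))\<^sup>2) = u / 64 * (\<Sum>i\<in>UNIV - {k}. (cmod (w $ i))\<^sup>2)"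
    by (simp add: sum_distrib_left)
  also have "\<dots> \<le> u / 64 * (norm w)\<^sup>2"
    unfolding norm_vec_power2 using u by (intro mult_left_mono sum_mono2) auto
  also have "\<dots> \<le> u / 64 * 1"
    using u w by (intro mult_left_mono) (auto simp: power_le_one)
  also have "(cmod (x $ k))\<^sup>2 \<le> (1 - u + u / 8)\<^sup>2"
    using xk_le by (intro power_mono) auto
  finally have "(norm x)\<^sup>2 \<le> (1 - u + u / 8)\<^sup>2 + u / 64" by simp
  also have "\<dots> = 1 - 7 / 4 * u + 49 / 64 * (u * u) + u / 64" by (simp add: power2_eq_square field_simps)
  also have "\<dots> \<le> 1 - u / 2"
  proof -
    have "u * u \<le> u" using u by (intro mult_left_le) auto
    then show ?thesis using u by linarith
  qed
  finally show le: "u / 2 \<le> 1 - (norm x)\<^sup>2" by simp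
  then have "(norm x)\<^sup>2 < 1\<^sup>2" using u by simp
  then show lt: "norm x < 1" by (rule power2_less_imp_less) simp
  have "1 - u - u / 8 \<le> norm x"
    using xk_ge Finite_Cartesian_Product.norm_nth_le[of x k] by linarith
  moreover have "1 - (norm x)\<^sup>2 \<le> 2 * (1 - norm x)"
    using zero_le_power2[of "1 - norm x"] by (simp add: power2_eq_square algebra_simps)
  ultimately show "1 - (norm x)\<^sup>2 \<le> 4 * u" using u by simp
qed

text \<open>The sign of \<open>\<alpha>\<close> decides whether the lower or the upper bound on
  \<open>y\<close> is the relevant one; the absolute value gives one constant for both
  cases.\<close>

lemma powr_ge_comparable:
  fixes y u :: real
  assumes "0 < u" "u / 4 \<le> y" "y \<le> 4 * u"
  shows "4 powr - \<bar>\<alpha>\<bar> * u powr \<alpha> \<le> y powr \<alpha>"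
proof (cases "\<alpha> \<ge> 0")
  case True
  have "4 powr - \<bar>\<alpha>\<bar> * u powr \<alpha> = (u / 4) powr \<alpha>"
    using True assms by (simp add: powr_divide powr_minus field_simps)
  also have "\<dots> \<le> y powr \<alpha>" using True assms by (intro powr_mono2) auto
  finally show ?thesis .
next
  case False
  have "4 powr - \<bar>\<alpha>\<bar> * u powr \<alpha> = (4 * u) powr \<alpha>"
    using False assms by (simp add: powr_mult)
  also have "\<dots> \<le> y powr \<alpha>" using False assms by (intro powr_mono2') auto
  finally show ?thesis .
qed

lemma continuous_on_ball_weight:
  "continuous_on (ball 0 1) (\<lambda>z :: 'a::real_inner. (1 - (norm z)\<^sup>2) powr \<alpha>)"
proof (intro continuous_intros ballI)
  fix z :: 'a assume "z \<in> ball 0 1"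
  then have "(norm z)\<^sup>2 < 1" by (simp add: power_less_one_iff abs_square_less_1)
  then show "1 - (norm z)\<^sup>2 \<noteq> 0" by simp
qed

section \<open>Pointwise bound from nonisotropic ellipsoids\<close>

context growth_type
begin

text \<open>The weak mean value inequality is applied to \<open>f\<close> composed with the affine
  map onto the ellipsoid. There the weight is at least a multiple of \<open>u powr \<alpha>\<close>
  and the Jacobian is a multiple of \<open>u ^ (n + 1)\<close>; dividing by both gives the
  exponent.\<close>

lemma pointwise_bound_axis:
  fixes k :: "'n::finite"
  obtains C where "C > 0"
    "\<And>f u. (\<And>z :: complex ^ 'n. z \<in> ball 0 1 \<Longrightarrow> complex_differentiable f z) \<Longrightarrow> 0 < u \<Longrightarrow> u \<le> 1 \<Longrightarrow>
       ennreal (\<Phi> (cmod (f (axis k (of_real (1 - u)))))) \<le> ennreal (C * u powr - (real CARD('n) + 1 + \<alpha>)) *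
         (\<integral>\<^sup>+w. indicator (ball 0 1) w * ennreal ((1 - (norm w)\<^sup>2) powr \<alpha> * \<Phi> (cmod (f w))) \<partial>lborel)"
proof -
  define n where "n = CARD('n)"
  obtain C0 where C0: "C0 > 0"
    "\<And>g :: complex ^ 'n \<Rightarrow> complex. (\<And>z. z \<in> ball 0 1 \<Longrightarrow> complex_differentiable g z) \<Longrightarrow>
       continuous_on (cball 0 1) g \<Longrightarrow>
       ennreal (\<Phi> (cmod (g 0))) \<le>
         ennreal C0 * (\<integral>\<^sup>+w. indicator (ball 0 1) w * ennreal (\<Phi> (cmod (g w))) \<partial>lborel)"
    using weak_mean_value by blast
  define c where "c = 4 powr - \<bar>\<alpha>\<bar>"
  have c: "c > 0" by (simp add: c_def)
  define C where "C = C0 * 64 ^ n / c"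
  have "C > 0" using C0(1) c by (simp add: C_def)
  moreover have "ennreal (\<Phi> (cmod (f (axis k (of_real (1 - u)))))) \<le> ennreal (C * u powr - (real n + 1 + \<alpha>)) *
         (\<integral>\<^sup>+w. indicator (ball 0 1) w * ennreal ((1 - (norm w)\<^sup>2) powr \<alpha> * \<Phi> (cmod (f w))) \<partial>lborel)"
    if diff: "\<And>z :: complex ^ 'n. z \<in> ball 0 1 \<Longrightarrow> complex_differentiable f z" and u: "0 < u" "u \<le> 1" for f u
  proof -
    define z where "z = (axis k (of_real (1 - u)) :: complex ^ 'n)"
    define l where "l = (\<lambda>i. if i = k then u / 8 else sqrt u / 8)"
    define S where "S = (\<lambda>w :: complex ^ 'n. \<chi> i. l i *\<^sub>R w $ i)"
    define H where "H = (\<lambda>w. indicator (ball 0 1) w * ennreal ((1 - (norm w)\<^sup>2) powr \<alpha> * \<Phi> (cmod (f w))))"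
    have l: "l i > 0" for i using u by (simp add: l_def)
    have bounds: "u / 2 \<le> 1 - (norm (z + S w))\<^sup>2" "1 - (norm (z + S w))\<^sup>2 \<le> 4 * u" "norm (z + S w) < 1"
      if "norm w \<le> 1" for w
      using nonisotropic_ellipsoid_bounds[OF u that, of "z + S w" k] by (simp_all add: z_def S_def l_def)
    have linS: "bounded_linear S" unfolding linear_linear
      by (rule linearI) (simp_all add: S_def vec_eq_iff scaleR_add_right)
    have S_smult: "S (a *s v) = a *s S v" for a v by (simp add: S_def vec_eq_iff)
    have diffg: "complex_differentiable (\<lambda>w. f (z + S w)) w" if "norm w \<le> 1" for w
      using bounds(3)[OF that] by (intro complex_differentiable_compose_affine diff linS S_smult) auto
    have "continuous_on (ball 0 1) (\<lambda>w. (1 - (norm w)\<^sup>2) powr \<alpha> * \<Phi> (cmod (f w)))"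
      by (intro continuous_on_mult continuous_on_ball_weight continuous_on_norm_compose
          complex_differentiable_imp_continuous_on diff)
    then have H[measurable]: "H \<in> borel_measurable borel" unfolding H_def
      by (intro borel_measurable_indicator_continuous_on) auto
    \<comment> \<open>The normal coordinate contributes \<open>u ^ 2 / 64\<close> and each of the
      \<open>n - 1\<close> others \<open>u / 64\<close>; this is the source of \<open>n + 1\<close>
      in the exponent.\<close>
    have prod: "(\<Prod>i\<in>UNIV. l i ^ DIM(complex)) = u ^ (n + 1) / 64 ^ n"
    proof -
      have "(\<Prod>i\<in>UNIV. l i ^ DIM(complex)) = l k ^ 2 * (\<Prod>i\<in>UNIV - {k}. l i ^ 2)"
        by (subst prod.remove[of _ k]) auto
      also have "(\<Prod>i\<in>UNIV - {k}. l i ^ 2) = (\<Prod>i\<in>UNIV - {k}. u / 64)"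
        using u by (intro prod.cong) (auto simp: l_def power_divide)
      also have "\<dots> = (u / 64) ^ (n - 1)" by (simp add: n_def)
      also have "l k ^ 2 * (u / 64) ^ (n - 1) = u * ((u / 64) * (u / 64) ^ (n - 1))"
        by (simp add: l_def power2_eq_square)
      also have "(u / 64) * (u / 64) ^ (n - 1) = (u / 64) ^ n"
        by (simp add: power_eq_if n_def)
      finally show ?thesis by (simp add: power_divide)
    qed
    have "S 0 = 0" by (simp add: S_def vec_eq_iff)
    moreover have "continuous_on (cball 0 1) (\<lambda>w. f (z + S w))"
      using diffg by (intro complex_differentiable_imp_continuous_on) auto
    ultimately have "ennreal (\<Phi> (cmod (f z))) \<le>
        ennreal C0 * (\<integral>\<^sup>+w. indicator (ball 0 1) w * ennreal (\<Phi> (cmod (f (z + S w)))) \<partial>lborel)"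
      using C0(2)[of "\<lambda>w. f (z + S w)"] diffg by simp
    also have "\<dots> \<le> ennreal C0 * (\<integral>\<^sup>+w. ennreal (u powr - \<alpha> / c) * H (z + S w) \<partial>lborel)"
    proof (intro mult_left_mono nn_integral_mono)
      fix w :: "complex ^ 'n"
      show "indicator (ball 0 1) w * ennreal (\<Phi> (cmod (f (z + S w)))) \<le> ennreal (u powr - \<alpha> / c) * H (z + S w)"
      proof (cases "w \<in> ball 0 1")
        case True
        then have w: "norm w \<le> 1" by simp
        have "c * u powr \<alpha> \<le> (1 - (norm (z + S w))\<^sup>2) powr \<alpha>"
          unfolding c_def using bounds[OF w] u by (intro powr_ge_comparable) auto
        then have "c * u powr \<alpha> * (u powr - \<alpha> / c) \<le> u powr - \<alpha> / c * (1 - (norm (z + S w))\<^sup>2) powr \<alpha>"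
          using c by (subst mult.commute) (intro mult_left_mono, auto)
        also have "c * u powr \<alpha> * (u powr - \<alpha> / c) = 1"
          using u c by (simp add: powr_minus field_simps)
        finally have "1 * \<Phi> (cmod (f (z + S w))) \<le>
            u powr - \<alpha> / c * (1 - (norm (z + S w))\<^sup>2) powr \<alpha> * \<Phi> (cmod (f (z + S w)))"
          by (intro mult_right_mono nonneg) auto
        then show ?thesis using True bounds(3)[OF w] c nonneg[of "cmod (f (z + S w))"]
          by (auto simp: H_def ennreal_mult[symmetric] mult.assoc intro!: ennreal_leI)
      qed simp
    qed auto
    also have "\<dots> = ennreal (C0 * u powr - \<alpha> / c) * (\<integral>\<^sup>+w. H (z + S w) \<partial>lborel)"
    proof -
      have [measurable]: "S \<in> borel_measurable borel"
        by (intro borel_measurable_continuous_onI linear_continuous_on linS)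
      show ?thesis using C0(1) c
        by (simp add: nn_integral_cmult ennreal_mult mult.assoc flip: times_divide_eq_right)
    qed
    also have "\<dots> = ennreal (C0 * u powr - \<alpha> / c) * (ennreal (64 ^ n / u ^ (n + 1)) * (\<integral>\<^sup>+w. H w \<partial>lborel))"
    proof -
      have "(\<integral>\<^sup>+w. H w \<partial>lborel) = ennreal (u ^ (n + 1) / 64 ^ n) * (\<integral>\<^sup>+w. H (z + S w) \<partial>lborel)"
        using nn_integral_lborel_diagonal_vec[OF H, where l=l and t=z, OF l] unfolding S_def prod .
      then have "ennreal (64 ^ n / u ^ (n + 1)) * (\<integral>\<^sup>+w. H w \<partial>lborel) =
          ennreal (64 ^ n / u ^ (n + 1) * (u ^ (n + 1) / 64 ^ n)) * (\<integral>\<^sup>+w. H (z + S w) \<partial>lborel)"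
        using u by (simp only: mult.assoc[symmetric]) (subst ennreal_mult, auto)
      also have "64 ^ n / u ^ (n + 1) * (u ^ (n + 1) / 64 ^ n) = 1" using u by simp
      finally show ?thesis by simp
    qed
    also have "\<dots> = ennreal (C0 * u powr - \<alpha> / c * (64 ^ n / u ^ (n + 1))) * (\<integral>\<^sup>+w. H w \<partial>lborel)"
      using u c C0(1) by (simp only: mult.assoc[symmetric]) (subst ennreal_mult, auto)
    also have "C0 * u powr - \<alpha> / c * (64 ^ n / u ^ (n + 1)) = C * u powr - (real n + 1 + \<alpha>)"
    proof -
      have "u powr - (real n + 1 + \<alpha>) = u powr - \<alpha> / u powr (real (n + 1))"
      proof -
        have "- (real n + 1 + \<alpha>) = - \<alpha> - real (n + 1)" by simp
        then show ?thesis by (simp only: powr_diff)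
      qed
      also have "u powr real (n + 1) = u ^ (n + 1)" using u by (intro powr_realpow)
      finally show ?thesis by (simp add: C_def)
    qed
    finally show ?thesis unfolding z_def H_def .
  qed
  ultimately show ?thesis unfolding n_def by (rule that)
qed

text \<open>A unitary map carries a point of the \<open>k\<close>-axis to \<open>z\<close>. Lebesgue
  measure, the ball and the weight are invariant under it, so the constant found on the axis serves
  every \<open>z\<close>.\<close>

lemma pointwise_bound:
  obtains C where "C > 0"
    "\<And>f z. (\<And>z :: complex ^ 'n. z \<in> ball 0 1 \<Longrightarrow> complex_differentiable f z) \<Longrightarrow> z \<in> ball 0 1 \<Longrightarrow>
       ennreal (\<Phi> (cmod (f z))) \<le> ennreal (C * (1 - norm z) powr - (real CARD('n) + 1 + \<alpha>)) *
         (\<integral>\<^sup>+w. indicator (ball 0 1) w * ennreal ((1 - (norm w)\<^sup>2) powr \<alpha> * \<Phi> (cmod (f w))) \<partial>lborel)"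
proof -
  define k where "k = (undefined :: 'n)"
  obtain C where C: "C > 0"
    "\<And>f u. (\<And>z :: complex ^ 'n. z \<in> ball 0 1 \<Longrightarrow> complex_differentiable f z) \<Longrightarrow> 0 < u \<Longrightarrow> u \<le> 1 \<Longrightarrow>
       ennreal (\<Phi> (cmod (f (axis k (of_real (1 - u)))))) \<le> ennreal (C * u powr - (real CARD('n) + 1 + \<alpha>)) *
         (\<integral>\<^sup>+w. indicator (ball 0 1) w * ennreal ((1 - (norm w)\<^sup>2) powr \<alpha> * \<Phi> (cmod (f w))) \<partial>lborel)"
    using pointwise_bound_axis[of k \<alpha>] by blast
  show ?thesis
  proof (rule that[OF C(1)])
    fix f and z :: "complex ^ 'n"
    assume diff: "\<And>z :: complex ^ 'n. z \<in> ball 0 1 \<Longrightarrow> complex_differentiable f z" and z: "z \<in> ball 0 1"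
    obtain T where T: "orthogonal_transformation T" "\<And>a v. T (a *s v) = a *s T v"
      "T (axis k (of_real (norm z))) = z" using exists_unitary_axis[of k z] by blast
    have normT: "norm (T w) = norm w" for w
      using T(1) by (rule orthogonal_transformation_norm)
    have linT: "bounded_linear T"
      unfolding linear_linear using T(1) by (rule orthogonal_transformation_linear)
    define H where "H = (\<lambda>w. indicator (ball 0 1) w * ennreal ((1 - (norm w)\<^sup>2) powr \<alpha> * \<Phi> (cmod (f w))))"
    have "continuous_on (ball 0 1) (\<lambda>w. (1 - (norm w)\<^sup>2) powr \<alpha> * \<Phi> (cmod (f w)))"
      by (intro continuous_on_mult continuous_on_ball_weight continuous_on_norm_compose
          complex_differentiable_imp_continuous_on diff)
    then have H[measurable]: "H \<in> borel_measurable borel" unfolding H_def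
      by (intro borel_measurable_indicator_continuous_on) auto
    have "complex_differentiable (\<lambda>w. f (0 + T w)) w" if "w \<in> ball 0 1" for w
      using that by (intro complex_differentiable_compose_affine diff linT T(2)) (simp add: normT)
    from C(2)[of "\<lambda>w. f (0 + T w)" "1 - norm z", OF this] z
    have "ennreal (\<Phi> (cmod (f z))) \<le> ennreal (C * (1 - norm z) powr - (real CARD('n) + 1 + \<alpha>)) *
         (\<integral>\<^sup>+w. H (T w) \<partial>lborel)"
      by (simp add: T(3) H_def normT indicator_def)
    also have "(\<integral>\<^sup>+w. H (T w) \<partial>lborel) = (\<integral>\<^sup>+w. H w \<partial>lborel)"
      by (rule nn_integral_lborel_orthogonal[OF H T(1)])
    finally show "ennreal (\<Phi> (cmod (f z))) \<le> ennreal (C * (1 - norm z) powr - (real CARD('n) + 1 + \<alpha>)) *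
         (\<integral>\<^sup>+w. indicator (ball 0 1) w * ennreal ((1 - (norm w)\<^sup>2) powr \<alpha> * \<Phi> (cmod (f w))) \<partial>lborel)"
      by (simp add: H_def)
  qed
qed

end

section \<open>Weighted integrals over the ball\<close>

text \<open>For negative \<open>\<alpha>\<close> the integrand blows up at \<open>1 / m\<close>, but
  the antiderivative is a power with exponent \<open>\<alpha> + 1 > 0\<close> and hence continuous
  up to that endpoint, so differentiating it in the interior suffices.\<close>

lemma nn_integral_one_minus_powr:
  fixes m \<alpha> :: real
  assumes m: "0 < m" "m \<le> 1" and \<alpha>: "\<alpha> > -1"
  shows "(\<integral>\<^sup>+s. indicator {1..1/m} s * ennreal ((1 - s * m) powr \<alpha>) \<partial>lborel) =
    ennreal ((1 - m) powr (\<alpha> + 1) / (m * (\<alpha> + 1)))"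
proof -
  define F where "F = (\<lambda>s. - ((1 - s * m) powr (\<alpha> + 1)) / (m * (\<alpha> + 1)))"
  have "((\<lambda>s. (1 - s * m) powr \<alpha>) has_integral (F (1/m) - F 1)) {1..1/m}"
  proof (rule fundamental_theorem_of_calculus_interior)
    show "1 \<le> 1 / m" using m by simp
    show "continuous_on {1..1/m} F" unfolding F_def
      using m \<alpha> by (intro continuous_on_divide continuous_on_minus continuous_on_powr' continuous_on_diff
          continuous_on_mult continuous_on_const continuous_on_id) (auto simp: pos_le_divide_eq)
    fix s assume "s \<in> {1<..<1/m}"
    then have "1 - s * m > 0" using m by (auto simp: field_simps)
    then show "(F has_vector_derivative (1 - s * m) powr \<alpha>) (at s)"
    proof -
      assume "1 - s * m > 0"
      moreover have "((\<lambda>s. 1 - s * m) has_real_derivative - m) (at s)"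
        by (auto intro!: derivative_eq_intros)
      ultimately have "((\<lambda>s. (1 - s * m) powr (\<alpha> + 1)) has_real_derivative
          (\<alpha> + 1) * (1 - s * m) powr (\<alpha> + 1 - 1) * - m) (at s)"
        by (intro DERIV_chain2[of "\<lambda>x. x powr (\<alpha> + 1)"] has_real_derivative_powr)
      from DERIV_cdivide[OF DERIV_minus[OF this], of "m * (\<alpha> + 1)"] show ?thesis
        using m \<alpha> by (simp add: F_def has_real_derivative_iff_has_vector_derivative mult.assoc)
    qed
  qed
  moreover have "F (1/m) - F 1 = (1 - m) powr (\<alpha> + 1) / (m * (\<alpha> + 1))"
    using m \<alpha> by (simp add: F_def)
  ultimately have "(\<integral>\<^sup>+s. ennreal (indicator {1..1/m} s * (1 - s * m) powr \<alpha>) \<partial>lborel) =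
    ennreal ((1 - m) powr (\<alpha> + 1) / (m * (\<alpha> + 1)))"
    by (intro nn_integral_has_integral_lebesgue) auto
  moreover have "ennreal (indicator {1..1/m} s * (1 - s * m) powr \<alpha>) =
      indicator {1..1/m} s * ennreal ((1 - s * m) powr \<alpha>)" for s
    by (simp add: indicator_def)
  ultimately show ?thesis by simp
qed

lemma powr_le_comparable:
  fixes y :: real
  assumes "1 / 4 \<le> y" "y \<le> 4"
  shows "y powr \<alpha> \<le> 4 powr \<bar>\<alpha>\<bar>"
  using powr_ge_comparable[of 1 y "-\<alpha>"] assms
  by (simp add: powr_minus field_simps)

text \<open>Since \<open>\<integral> g = s\<^sup>d \<integral> g (s x)\<close> for every scaling factor \<open>s\<close>, one may average over
  \<open>1 \<le> s \<le> 1 + \<delta>\<close>; the radial integral then absorbs the singularity of the weight at the sphere.\<close>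
lemma weighted_cap_integral_le_aux:
  fixes k :: "'n::finite"
  assumes \<alpha>: "\<alpha> > -1"
  obtains K where "K > 0" "\<And>\<delta>. 0 < \<delta> \<Longrightarrow> \<delta> \<le> 2 \<Longrightarrow>
    (\<integral>\<^sup>+z. indicator {z \<in> ball 0 1. cmod (1 - z $ k) < \<delta>} z * ennreal ((1 - (norm (z :: complex ^ 'n))\<^sup>2) powr \<alpha>) \<partial>lborel)
      \<le> ennreal (K * \<delta> powr (real CARD('n) + 1 + \<alpha>))"
proof -
  define n where "n = CARD('n)"
  define d where "d = DIM(complex ^ 'n)"
  \<comment> \<open>The unit polydisc, of which \<open>Q\<close> below is a translated diagonal
    rescaling; what matters is that its volume is finite.\<close>
  define P where "P = {w :: complex ^ 'n. \<forall>i. cmod (w $ i) \<le> 1}"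
  define W where "W = measure lborel P"
  have "P \<subseteq> cball 0 (real n)"
  proof
    fix w assume "w \<in> P"
    then have "(norm w)\<^sup>2 \<le> real n"
      unfolding norm_vec_power2 n_def P_def
      using sum_mono[of UNIV "\<lambda>i. (cmod (w $ i))\<^sup>2" "\<lambda>i. 1"] by (auto simp: power_le_one)
    also have "\<dots> \<le> (real n)\<^sup>2" by (simp add: power2_eq_square n_def)
    finally show "w \<in> cball 0 (real n)" by (simp add: power2_le_iff_abs_le)
  qed
  moreover have P: "closed P" unfolding P_def
    by (intro closed_Collect_all closed_Collect_le continuous_intros)
  ultimately have "compact P" using bounded_cball bounded_subset compact_eq_bounded_closed by blast
  then have "emeasure lborel P < \<infinity>" by (rule emeasure_compact_finite)
  then have W: "emeasure lborel P = ennreal W" unfolding W_def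
    by (intro emeasure_eq_ennreal_measure) auto
  \<comment> \<open>The outer factor bounds \<open>(1 + s * m) powr \<alpha>\<close>; the two
    summands belong to the cases \<open>m \<ge> 1 / 4\<close> and \<open>m < 1 / 4\<close>.\<close>
  define L where "L = 2 powr \<bar>\<alpha>\<bar> * (4 * 2 powr (\<alpha> + 1) / (\<alpha> + 1) + 4 powr \<bar>\<alpha>\<bar> * 4 powr \<bar>\<alpha>\<bar>)"
  have L: "L > 0" using \<alpha> by (auto simp: L_def intro!: mult_pos_pos add_nonneg_pos)
  \<comment> \<open>The factor \<open>3 ^ d\<close> comes from
    \<open>s \<le> 1 + \<delta> \<le> 3\<close>; adding 1 makes \<open>K\<close> positive whatever
    \<open>W\<close> is.\<close>
  define K where "K = 3 ^ d * L * 2 ^ (n + 1) * W + 1"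
  have K: "K > 0" using L by (simp add: K_def W_def add_nonneg_pos)
  have "(\<integral>\<^sup>+z. indicator {z \<in> ball 0 1. cmod (1 - z $ k) < \<delta>} z * ennreal ((1 - (norm (z :: complex ^ 'n))\<^sup>2) powr \<alpha>) \<partial>lborel)
      \<le> ennreal (K * \<delta> powr (real n + 1 + \<alpha>))" if \<delta>: "0 < \<delta>" "\<delta> \<le> 2" for \<delta>
  proof -
    define E where "E = {z :: complex ^ 'n. z \<in> ball 0 1 \<and> cmod (1 - z $ k) < \<delta>}"
    define g where "g = (\<lambda>z. indicator E z * ennreal ((1 - (norm z)\<^sup>2) powr \<alpha>))"
    have "E = ball 0 1 \<inter> {z. cmod (1 - z $ k) < \<delta>}" by (auto simp: E_def)
    also have "open \<dots>" by (intro open_Int open_ball open_Collect_less continuous_intros)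
    finally have "open E" .
    then have g[measurable]: "g \<in> borel_measurable borel" unfolding g_def
      by (intro borel_measurable_indicator_continuous_on continuous_on_subset[OF continuous_on_ball_weight])
        (auto simp: E_def)
    define l where "l = (\<lambda>i. if i = k then 2 * \<delta> else sqrt (2 * \<delta>))"
    define S where "S = (\<lambda>w :: complex ^ 'n. \<chi> i. l i *\<^sub>R w $ i)"
    define t where "t = (axis k 1 :: complex ^ 'n)"
    \<comment> \<open>Contains every \<open>x\<close> for which some \<open>s *\<^sub>R x\<close>
      with \<open>1 \<le> s \<le> 1 + \<delta>\<close> lies in the cap \<open>E\<close>; its volume
      is at most of order \<open>\<delta> ^ (n + 1)\<close>.\<close>
    define Q where "Q = {x :: complex ^ 'n. \<forall>i. cmod (x $ i - t $ i) \<le> l i}"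
    have l: "l i > 0" for i using \<delta> by (simp add: l_def)
    have Q: "closed Q" unfolding Q_def
      by (intro closed_Collect_all closed_Collect_le continuous_intros)
    have "emeasure lborel Q = ennreal (\<Prod>i\<in>UNIV. l i ^ DIM(complex)) * emeasure lborel P"
    proof -
      have ind: "indicator Q (t + S w) = (indicator P w :: ennreal)" for w
      proof -
        have "l i * cmod (w $ i) \<le> l i \<longleftrightarrow> cmod (w $ i) \<le> 1" for i using l[of i] by simp
        then show ?thesis using l by (simp add: indicator_def Q_def P_def S_def less_imp_le)
      qed
      then show ?thesis
        using nn_integral_lborel_diagonal_vec[of "indicator Q" l t, OF _ l] Q P
        by (simp add: ind[unfolded S_def] borel_measurable_indicator borel_closed)
    qed
    also have "(\<Prod>i\<in>UNIV. l i ^ DIM(complex)) = (2 * \<delta>) ^ (n + 1)"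
    proof -
      have "(\<Prod>i\<in>UNIV. l i ^ DIM(complex)) = l k ^ 2 * (\<Prod>i\<in>UNIV - {k}. l i ^ 2)"
        by (subst prod.remove[of _ k]) auto
      also have "(\<Prod>i\<in>UNIV - {k}. l i ^ 2) = (\<Prod>i\<in>UNIV - {k}. 2 * \<delta>)"
        using \<delta> by (intro prod.cong) (auto simp: l_def)
      also have "\<dots> = (2 * \<delta>) ^ (n - 1)" by (simp add: n_def)
      also have "l k ^ 2 * (2 * \<delta>) ^ (n - 1) = (2 * \<delta>) ^ (2 + (n - 1))"
        by (simp only: l_def if_True refl power_add)
      also have "2 + (n - 1) = n + 1" by (simp add: n_def Suc_leI)
      finally show ?thesis .
    qed
    finally have vol: "emeasure lborel Q = ennreal ((2 * \<delta>) ^ (n + 1) * W)"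
      using \<delta> by (simp add: W ennreal_mult W_def)
    have inner: "(\<integral>\<^sup>+s. indicator {1..1 + \<delta>} s * g (s *\<^sub>R x) \<partial>lborel) \<le>
        ennreal (L * \<delta> powr (\<alpha> + 1)) * indicator Q x" for x :: "complex ^ 'n"
    proof (cases "\<exists>s\<in>{1..1 + \<delta>}. s *\<^sub>R x \<in> E")
      case False
      then have "indicator {1..1 + \<delta>} s * g (s *\<^sub>R x) = 0" for s
        by (auto simp: g_def indicator_def)
      then show ?thesis by (simp only: nn_integral_const) simp
    next
      case True
      then obtain s0 where s0: "1 \<le> s0" "s0 \<le> 1 + \<delta>" "norm (s0 *\<^sub>R x) < 1" "cmod (1 - (s0 *\<^sub>R x) $ k) < \<delta>"
        by (auto simp: E_def)
      define m where "m = norm x"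
      have "1 * norm x \<le> s0 * norm x" using s0(1) by (intro mult_right_mono) auto
      then have m1: "m < 1" "0 \<le> m" using s0 by (auto simp: m_def)
      have xk: "cmod (x $ k) \<le> m" unfolding m_def by (rule Finite_Cartesian_Product.norm_nth_le)
      have "cmod (1 - x $ k) \<le> cmod (1 - (s0 *\<^sub>R x) $ k) + cmod ((s0 - 1) *\<^sub>R x $ k)"
        using norm_triangle_ineq[of "1 - (s0 *\<^sub>R x) $ k" "(s0 - 1) *\<^sub>R x $ k"] by (simp add: algebra_simps)
      also have "cmod ((s0 - 1) *\<^sub>R x $ k) \<le> \<delta> * 1"
        unfolding norm_scaleR using s0 xk m1 by (intro mult_mono) auto
      finally have xk2: "cmod (1 - x $ k) < 2 * \<delta>" using s0 by simp
      have "x \<in> Q" unfolding Q_def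
      proof (intro CollectI allI)
        fix i
        show "cmod (x $ i - t $ i) \<le> l i"
        proof (cases "i = k")
          case True
          then show ?thesis using xk2 by (simp add: t_def l_def norm_minus_commute)
        next
          case False
          \<comment> \<open>In the unit ball the coordinates other than \<open>k\<close> are at most
            of order \<open>sqrt (1 - cmod (y $ k))\<close>, which explains the anisotropic shape of
            \<open>Q\<close>.\<close>
          define y where "y = s0 *\<^sub>R x"
          have "(cmod (y $ i))\<^sup>2 + (cmod (y $ k))\<^sup>2 = (\<Sum>j\<in>{i, k}. (cmod (y $ j))\<^sup>2)"
            using False by simp
          also have "\<dots> \<le> (norm y)\<^sup>2" unfolding norm_vec_power2 by (intro sum_mono2) auto
          also have "\<dots> \<le> 1" using s0(3) by (simp add: y_def power_le_one)
          finally have "(cmod (y $ i))\<^sup>2 \<le> 1 - (cmod (y $ k))\<^sup>2" by simp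
          also have "\<dots> \<le> 2 * (1 - cmod (y $ k))"
            using zero_le_power2[of "1 - cmod (y $ k)"] by (simp add: power2_eq_square algebra_simps)
          also have "\<dots> \<le> 2 * \<delta>"
            using norm_triangle_ineq2[of 1 "y $ k"] s0(4) by (simp add: y_def)
          finally have "cmod (y $ i) \<le> sqrt (2 * \<delta>)" by (rule real_le_rsqrt)
          moreover have "1 * cmod (x $ i) \<le> cmod (y $ i)"
            using s0(1) mult_right_mono[of 1 s0 "cmod (x $ i)"] by (simp add: y_def)
          ultimately show ?thesis using False by (simp add: t_def l_def axis_def)
        qed
      qed
      have weight: "g (s *\<^sub>R x) \<le> ennreal (2 powr \<bar>\<alpha>\<bar>) * (indicator {s. s * m < 1} s * ennreal ((1 - s * m) powr \<alpha>))"
        if s: "s \<ge> 1" for s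
      proof (cases "s *\<^sub>R x \<in> E")
        case True
        then have sm: "s * m < 1" using s by (simp add: E_def m_def)
        have "(1 - (norm (s *\<^sub>R x))\<^sup>2) = (1 + s * m) * (1 - s * m)"
          using s by (simp add: m_def power2_eq_square algebra_simps)
        then have "(1 - (norm (s *\<^sub>R x))\<^sup>2) powr \<alpha> = (1 + s * m) powr \<alpha> * (1 - s * m) powr \<alpha>"
          using sm s m1 by (simp add: powr_mult)
        also have "(1 + s * m) powr \<alpha> \<le> 2 powr \<bar>\<alpha>\<bar>"
        proof (rule order_trans)
          show "(1 + s * m) powr \<alpha> \<le> (1 + s * m) powr \<bar>\<alpha>\<bar>" using s m1 by (intro powr_mono) auto
          show "(1 + s * m) powr \<bar>\<alpha>\<bar> \<le> 2 powr \<bar>\<alpha>\<bar>" using s m1 sm by (intro powr_mono2) auto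
        qed
        finally show ?thesis using True sm
          by (simp add: g_def ennreal_mult[symmetric] mult_right_mono ennreal_leI)
      qed (simp add: g_def)
      have "(\<integral>\<^sup>+s. indicator {1..1 + \<delta>} s * g (s *\<^sub>R x) \<partial>lborel) \<le>
          (\<integral>\<^sup>+s. ennreal (2 powr \<bar>\<alpha>\<bar>) * (indicator {1..1 + \<delta>} s *
             (indicator {s. s * m < 1} s * ennreal ((1 - s * m) powr \<alpha>))) \<partial>lborel)"
      proof (rule nn_integral_mono)
        fix s
        show "indicator {1..1 + \<delta>} s * g (s *\<^sub>R x) \<le> ennreal (2 powr \<bar>\<alpha>\<bar>) * (indicator {1..1 + \<delta>} s *
             (indicator {s. s * m < 1} s * ennreal ((1 - s * m) powr \<alpha>)))"
          using weight[of s] by (cases "s \<in> {1..1 + \<delta>}") auto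
      qed
      also have "\<dots> = ennreal (2 powr \<bar>\<alpha>\<bar>) * (\<integral>\<^sup>+s. indicator {1..1 + \<delta>} s *
             (indicator {s. s * m < 1} s * ennreal ((1 - s * m) powr \<alpha>)) \<partial>lborel)"
        by (rule nn_integral_cmult) measurable
      also have "(\<integral>\<^sup>+s. indicator {1..1 + \<delta>} s * (indicator {s. s * m < 1} s * ennreal ((1 - s * m) powr \<alpha>)) \<partial>lborel) \<le>
          ennreal (4 * 2 powr (\<alpha> + 1) / (\<alpha> + 1) * \<delta> powr (\<alpha> + 1) + 4 powr \<bar>\<alpha>\<bar> * 4 powr \<bar>\<alpha>\<bar> * \<delta> powr (\<alpha> + 1))"
      \<comment> \<open>For \<open>m \<ge> 1 / 4\<close> the bounding radial integral is explicit.
        For \<open>m < 1 / 4\<close>, \<open>s * m \<le> 3 / 4\<close> keeps the weight bounded, and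
        \<open>1 - m \<le> 2 * \<delta>\<close> bounds \<open>\<delta>\<close> from below, so powers
        of \<open>\<delta>\<close> cost only constants.\<close>
      proof (cases "m \<ge> 1 / 4")
        case True
        have "(\<integral>\<^sup>+s. indicator {1..1 + \<delta>} s * (indicator {s. s * m < 1} s * ennreal ((1 - s * m) powr \<alpha>)) \<partial>lborel) \<le>
            (\<integral>\<^sup>+s. indicator {1..1/m} s * ennreal ((1 - s * m) powr \<alpha>) \<partial>lborel)"
          using True by (intro nn_integral_mono) (auto simp: indicator_def field_simps)
        also have "\<dots> = ennreal ((1 - m) powr (\<alpha> + 1) / (m * (\<alpha> + 1)))"
          using True m1 \<alpha> by (intro nn_integral_one_minus_powr) auto
        also have "\<dots> \<le> ennreal (4 * 2 powr (\<alpha> + 1) / (\<alpha> + 1) * \<delta> powr (\<alpha> + 1))"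
        proof (rule ennreal_leI)
          have "1 - m \<le> 2 * \<delta>" using xk xk2 norm_triangle_ineq2[of 1 "x $ k"] by simp
          then have "(1 - m) powr (\<alpha> + 1) \<le> (2 * \<delta>) powr (\<alpha> + 1)"
            using m1 \<alpha> by (intro powr_mono2) auto
          then have "(1 - m) powr (\<alpha> + 1) / (m * (\<alpha> + 1)) \<le> (2 * \<delta>) powr (\<alpha> + 1) / (1 / 4 * (\<alpha> + 1))"
            using True \<alpha> by (intro frac_le mult_right_mono) auto
          then show "(1 - m) powr (\<alpha> + 1) / (m * (\<alpha> + 1)) \<le> 4 * 2 powr (\<alpha> + 1) / (\<alpha> + 1) * \<delta> powr (\<alpha> + 1)"
            using \<delta> by (simp add: powr_mult mult.commute mult.left_commute)
        qed
        also have "\<dots> \<le> ennreal (4 * 2 powr (\<alpha> + 1) / (\<alpha> + 1) * \<delta> powr (\<alpha> + 1) + 4 powr \<bar>\<alpha>\<bar> * 4 powr \<bar>\<alpha>\<bar> * \<delta> powr (\<alpha> + 1))"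
          by (intro ennreal_leI) simp
        finally show ?thesis .
      next
        case False
        have "(\<integral>\<^sup>+s. indicator {1..1 + \<delta>} s * (indicator {s. s * m < 1} s * ennreal ((1 - s * m) powr \<alpha>)) \<partial>lborel) \<le>
            (\<integral>\<^sup>+s. ennreal (4 powr \<bar>\<alpha>\<bar>) * indicator {1..1 + \<delta>} s \<partial>lborel)"
        proof (intro nn_integral_mono)
          fix s
          show "indicator {1..1 + \<delta>} s * (indicator {s. s * m < 1} s * ennreal ((1 - s * m) powr \<alpha>)) \<le>
            ennreal (4 powr \<bar>\<alpha>\<bar>) * indicator {1..1 + \<delta>} s"
          proof (cases "s \<in> {1..1 + \<delta>}")
            case True
            then have "s * m \<le> 3 * (1 / 4)" using False \<delta> m1 by (intro mult_mono) auto
            moreover have "0 \<le> s * m" using True m1 by simp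
            ultimately have "(1 - s * m) powr \<alpha> \<le> 4 powr \<bar>\<alpha>\<bar>" by (intro powr_le_comparable) auto
            then show ?thesis using True by (auto simp: indicator_def intro!: ennreal_leI)
          qed simp
        qed
        also have "\<dots> = ennreal (4 powr \<bar>\<alpha>\<bar> * \<delta>)"
          using \<delta> by (simp add: nn_integral_cmult ennreal_mult)
        also have "\<dots> \<le> ennreal (4 powr \<bar>\<alpha>\<bar> * 4 powr \<bar>\<alpha>\<bar> * \<delta> powr (\<alpha> + 1))"
        proof (rule ennreal_leI)
          have "1 - m \<le> 2 * \<delta>" using xk xk2 norm_triangle_ineq2[of 1 "x $ k"] by simp
          then have "\<delta> powr (-\<alpha>) \<le> 4 powr \<bar>- \<alpha>\<bar>" using False \<delta> by (intro powr_le_comparable) auto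
          then have "\<delta> powr (-\<alpha>) * \<delta> powr (\<alpha> + 1) \<le> 4 powr \<bar>\<alpha>\<bar> * \<delta> powr (\<alpha> + 1)"
            by (intro mult_right_mono) auto
          then have "\<delta> \<le> 4 powr \<bar>\<alpha>\<bar> * \<delta> powr (\<alpha> + 1)" using \<delta> by (simp add: powr_add[symmetric])
          then show "4 powr \<bar>\<alpha>\<bar> * \<delta> \<le> 4 powr \<bar>\<alpha>\<bar> * 4 powr \<bar>\<alpha>\<bar> * \<delta> powr (\<alpha> + 1)"
            by (simp add: mult.assoc)
        qed
        also have "\<dots> \<le> ennreal (4 * 2 powr (\<alpha> + 1) / (\<alpha> + 1) * \<delta> powr (\<alpha> + 1) + 4 powr \<bar>\<alpha>\<bar> * 4 powr \<bar>\<alpha>\<bar> * \<delta> powr (\<alpha> + 1))"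
          using \<alpha> by (intro ennreal_leI) simp
        finally show ?thesis .
      qed
      finally have "(\<integral>\<^sup>+s. indicator {1..1 + \<delta>} s * g (s *\<^sub>R x) \<partial>lborel) \<le>
        ennreal (2 powr \<bar>\<alpha>\<bar>) * ennreal (4 * 2 powr (\<alpha> + 1) / (\<alpha> + 1) * \<delta> powr (\<alpha> + 1) + 4 powr \<bar>\<alpha>\<bar> * 4 powr \<bar>\<alpha>\<bar> * \<delta> powr (\<alpha> + 1))"
        by (simp add: mult_left_mono)
      also have "\<dots> = ennreal (L * \<delta> powr (\<alpha> + 1))"
        using \<alpha> by (subst ennreal_mult[symmetric]) (auto simp: L_def algebra_simps)
      finally show ?thesis using \<open>x \<in> Q\<close> by simp
    qed
    have scale: "(\<integral>\<^sup>+z. g z \<partial>lborel) \<le> ennreal (3 ^ d) * (\<integral>\<^sup>+x. g (s *\<^sub>R x) \<partial>lborel)" if "s \<in> {1..1 + \<delta>}" for s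
    proof -
      have "(\<integral>\<^sup>+z. g z \<partial>lborel) = ennreal (s ^ d) * (\<integral>\<^sup>+x. g (s *\<^sub>R x) \<partial>lborel)"
        using nn_integral_lborel_scale[OF g, of s 0] that by (simp add: d_def)
      also have "\<dots> \<le> ennreal (3 ^ d) * (\<integral>\<^sup>+x. g (s *\<^sub>R x) \<partial>lborel)"
        using that \<delta> by (intro mult_right_mono ennreal_leI power_mono) auto
      finally show ?thesis .
    qed
    have "(\<lambda>p. snd p *\<^sub>R fst p) \<in> borel_measurable (borel :: ((complex^'n) \<times> real) measure)"
      by (intro borel_measurable_continuous_onI continuous_intros)
    then have [measurable]: "(\<lambda>p. snd p *\<^sub>R fst p) \<in> borel_measurable ((borel :: (complex^'n) measure) \<Otimes>\<^sub>M (borel :: real measure))"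
      by (simp add: borel_prod)
    \<comment> \<open>Averaging over an interval of length \<open>\<delta>\<close> puts a factor
      \<open>\<delta>\<close> on the left, while the radial integral yields
      \<open>\<delta> powr (\<alpha> + 1)\<close>; the net gain
      \<open>\<delta> powr \<alpha>\<close> multiplies the volume of \<open>Q\<close>.\<close>
    have "ennreal \<delta> * (\<integral>\<^sup>+z. g z \<partial>lborel) = (\<integral>\<^sup>+s. indicator {1..1 + \<delta>} s * (\<integral>\<^sup>+z. g z \<partial>lborel) \<partial>lborel)"
      by (simp add: nn_integral_multc \<delta> less_imp_le)
    also have "\<dots> \<le> (\<integral>\<^sup>+s. (\<integral>\<^sup>+x. indicator {1..1 + \<delta>} s * (ennreal (3 ^ d) * g (s *\<^sub>R x)) \<partial>lborel) \<partial>lborel)"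
    proof (rule nn_integral_mono)
      fix s
      show "indicator {1..1 + \<delta>} s * (\<integral>\<^sup>+z. g z \<partial>lborel) \<le>
          (\<integral>\<^sup>+x. indicator {1..1 + \<delta>} s * (ennreal (3 ^ d) * g (s *\<^sub>R x)) \<partial>lborel)"
        using scale[of s] by (cases "s \<in> {1..1 + \<delta>}") (simp_all add: nn_integral_cmult)
    qed
    also have "\<dots> = (\<integral>\<^sup>+x. (\<integral>\<^sup>+s. indicator {1..1 + \<delta>} s * (ennreal (3 ^ d) * g (s *\<^sub>R x)) \<partial>lborel) \<partial>lborel)"
      by (rule lborel_pair.Fubini') measurable
    also have "\<dots> = (\<integral>\<^sup>+x. ennreal (3 ^ d) * (\<integral>\<^sup>+s. indicator {1..1 + \<delta>} s * g (s *\<^sub>R x) \<partial>lborel) \<partial>lborel)"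
      by (intro nn_integral_cong) (simp add: nn_integral_cmult[symmetric] mult.left_commute)
    also have "\<dots> \<le> (\<integral>\<^sup>+x. ennreal (3 ^ d) * (ennreal (L * \<delta> powr (\<alpha> + 1)) * indicator Q x) \<partial>lborel)"
      by (intro nn_integral_mono mult_left_mono inner) auto
    also have "\<dots> = ennreal (3 ^ d) * (ennreal (L * \<delta> powr (\<alpha> + 1)) * emeasure lborel Q)"
      using Q by (simp add: nn_integral_cmult borel_closed)
    also have "\<dots> = ennreal (3 ^ d * (L * \<delta> powr (\<alpha> + 1) * ((2 * \<delta>) ^ (n + 1) * W)))"
      unfolding vol using L \<delta> by (simp add: ennreal_mult W_def)
    also have "\<dots> \<le> ennreal (\<delta> * (K * \<delta> powr (real n + 1 + \<alpha>)))"
    proof (rule ennreal_leI)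
      have "\<delta> * \<delta> powr (real n + 1 + \<alpha>) = \<delta> powr (\<alpha> + 1) * \<delta> powr real (n + 1)"
        using \<delta> by (simp add: powr_mult_base powr_add[symmetric] algebra_simps)
      also have "\<delta> powr real (n + 1) = \<delta> ^ (n + 1)" using \<delta> by (intro powr_realpow)
      finally have eq: "\<delta> * \<delta> powr (real n + 1 + \<alpha>) = \<delta> powr (\<alpha> + 1) * \<delta> ^ (n + 1)" .
      have "3 ^ d * (L * \<delta> powr (\<alpha> + 1) * ((2 * \<delta>) ^ (n + 1) * W)) = (K - 1) * (\<delta> powr (\<alpha> + 1) * \<delta> ^ (n + 1))"
        by (simp add: K_def power_mult_distrib)
      also have "\<dots> \<le> K * (\<delta> powr (\<alpha> + 1) * \<delta> ^ (n + 1))"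
        using \<delta> by (intro mult_right_mono) auto
      also have "\<dots> = \<delta> * (K * \<delta> powr (real n + 1 + \<alpha>))" unfolding eq[symmetric] by simp
      finally show "3 ^ d * (L * \<delta> powr (\<alpha> + 1) * ((2 * \<delta>) ^ (n + 1) * W)) \<le> \<delta> * (K * \<delta> powr (real n + 1 + \<alpha>))" .
    qed
    also have "\<dots> = ennreal \<delta> * ennreal (K * \<delta> powr (real n + 1 + \<alpha>))"
      using \<delta> by (simp add: ennreal_mult')
    finally have "(\<integral>\<^sup>+z. g z \<partial>lborel) \<le> ennreal (K * \<delta> powr (real n + 1 + \<alpha>))"
      using \<delta> by (subst (asm) ennreal_mult_le_mult_iff) auto
    then show ?thesis by (simp add: g_def E_def)
  qed
  with K show ?thesis unfolding n_def by (rule that)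
qed

text \<open>Inside the unit ball \<open>cmod (1 - z $ k) < 2\<close>, so every cap of size beyond 2
  equals the cap of size 2.\<close>

lemma weighted_cap_integral_le:
  fixes k :: "'n::finite"
  assumes \<alpha>: "\<alpha> > -1"
  obtains K where "K > 0" "\<And>\<delta>. 0 < \<delta> \<Longrightarrow>
    (\<integral>\<^sup>+z. indicator {z \<in> ball 0 1. cmod (1 - z $ k) < \<delta>} z * ennreal ((1 - (norm (z :: complex ^ 'n))\<^sup>2) powr \<alpha>) \<partial>lborel)
      \<le> ennreal (K * \<delta> powr (real CARD('n) + 1 + \<alpha>))"
proof -
  obtain K where K: "K > 0" "\<And>\<delta>. 0 < \<delta> \<Longrightarrow> \<delta> \<le> 2 \<Longrightarrow>
    (\<integral>\<^sup>+z. indicator {z \<in> ball 0 1. cmod (1 - z $ k) < \<delta>} z * ennreal ((1 - (norm (z :: complex ^ 'n))\<^sup>2) powr \<alpha>) \<partial>lborel)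
      \<le> ennreal (K * \<delta> powr (real CARD('n) + 1 + \<alpha>))"
    using weighted_cap_integral_le_aux[OF \<alpha>] by blast
  show ?thesis
  proof (rule that[OF K(1)])
    fix \<delta> :: real assume \<delta>: "0 < \<delta>"
    have lt2: "cmod (1 - z $ k) < 2" if "z \<in> ball 0 1" for z :: "complex ^ 'n"
      using that norm_triangle_ineq4[of 1 "z $ k"] Finite_Cartesian_Product.norm_nth_le[of z k] by simp
    have "(\<integral>\<^sup>+z. indicator {z \<in> ball 0 1. cmod (1 - z $ k) < \<delta>} z * ennreal ((1 - (norm (z :: complex ^ 'n))\<^sup>2) powr \<alpha>) \<partial>lborel)
      \<le> (\<integral>\<^sup>+z. indicator {z \<in> ball 0 1. cmod (1 - z $ k) < min \<delta> 2} z * ennreal ((1 - (norm (z :: complex ^ 'n))\<^sup>2) powr \<alpha>) \<partial>lborel)"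
      using lt2 by (intro nn_integral_mono) (auto simp: indicator_def)
    also have "\<dots> \<le> ennreal (K * min \<delta> 2 powr (real CARD('n) + 1 + \<alpha>))"
      using \<delta> by (intro K(2)) auto
    also have "\<dots> \<le> ennreal (K * \<delta> powr (real CARD('n) + 1 + \<alpha>))"
      using \<delta> \<alpha> K(1) by (intro ennreal_leI mult_left_mono powr_mono2) auto
    finally show "(\<integral>\<^sup>+z. indicator {z \<in> ball 0 1. cmod (1 - z $ k) < \<delta>} z * ennreal ((1 - (norm (z :: complex ^ 'n))\<^sup>2) powr \<alpha>) \<partial>lborel)
      \<le> ennreal (K * \<delta> powr (real CARD('n) + 1 + \<alpha>))" .
  qed
qed

text \<open>The whole ball is the cap of size 2.\<close>

lemma nn_integral_ball_weight_finite:
  assumes "\<alpha> > -1"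
  shows "(\<integral>\<^sup>+z. indicator (ball 0 1) z * ennreal ((1 - (norm (z :: complex ^ 'n))\<^sup>2) powr \<alpha>) \<partial>lborel) < \<infinity>"
proof -
  fix k :: 'n
  obtain K where K: "\<And>\<delta>. 0 < \<delta> \<Longrightarrow>
    (\<integral>\<^sup>+z. indicator {z \<in> ball 0 1. cmod (1 - z $ k) < \<delta>} z * ennreal ((1 - (norm (z :: complex ^ 'n))\<^sup>2) powr \<alpha>) \<partial>lborel)
      \<le> ennreal (K * \<delta> powr (real CARD('n) + 1 + \<alpha>))"
    using weighted_cap_integral_le[OF assms] by blast
  have "cmod (1 - z $ k) < 2" if "norm z < 1" for z :: "complex ^ 'n"
    using that norm_triangle_ineq4[of 1 "z $ k"] Finite_Cartesian_Product.norm_nth_le[of z k] by simp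
  then have "{z :: complex ^ 'n. z \<in> ball 0 1 \<and> cmod (1 - z $ k) < 2} = ball 0 1" by auto
  then show ?thesis using K[of 2] le_less_trans[OF _ ennreal_less_top] by simp
qed

lemma nn_integral_ball_weight_pos:
  "0 < (\<integral>\<^sup>+z. indicator (ball 0 1) z * ennreal ((1 - (norm (z :: complex ^ 'n))\<^sup>2) powr \<alpha>) \<partial>lborel)"
proof -
  define c where "c = 4 powr - \<bar>\<alpha>\<bar>"
  have "0 < ennreal c * emeasure lborel (ball (0 :: complex ^ 'n) (1 / 2))"
    using content_ball_pos[of "1 / 2" "0 :: complex ^ 'n"]
    by (auto simp: c_def measure_def ennreal_zero_less_mult_iff zero_less_iff_neq_zero)
  also have "\<dots> = (\<integral>\<^sup>+z. ennreal c * indicator (ball (0 :: complex ^ 'n) (1 / 2)) z \<partial>lborel)"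
    by (simp add: nn_integral_cmult_indicator)
  also have "\<dots> \<le> (\<integral>\<^sup>+z. indicator (ball 0 1) z * ennreal ((1 - (norm (z :: complex ^ 'n))\<^sup>2) powr \<alpha>) \<partial>lborel)"
  proof (rule nn_integral_mono)
    fix z :: "complex ^ 'n"
    show "ennreal c * indicator (ball 0 (1 / 2)) z \<le> indicator (ball 0 1) z * ennreal ((1 - (norm z)\<^sup>2) powr \<alpha>)"
    proof (cases "z \<in> ball 0 (1 / 2)")
      case True
      then have "(norm z)\<^sup>2 \<le> (1 / 2)\<^sup>2" by (intro power_mono) auto
      then have "1 / 4 \<le> 1 - (norm z)\<^sup>2" "1 - (norm z)\<^sup>2 \<le> 4 * 1"
        using zero_le_power2[of "norm z"] by (simp add: power_divide, linarith)
      then have "c * 1 powr \<alpha> \<le> (1 - (norm z)\<^sup>2) powr \<alpha>"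
        unfolding c_def by (intro powr_ge_comparable) auto
      then show ?thesis using True by (auto intro!: ennreal_leI)
    qed simp
  qed
  finally show ?thesis .
qed

text \<open>Both finiteness and positivity of the total mass enter: \<open>enn2real\<close> sends an
  infinite mass to 0, and division by 0 yields 0.\<close>

lemma weight_const_pos:
  assumes "\<alpha> > -1"
  shows "weight_const \<alpha> TYPE('n::finite) > 0"
  using nn_integral_ball_weight_finite[OF assms, where 'n='n] nn_integral_ball_weight_pos[where 'n='n and \<alpha>=\<alpha>]
  by (simp add: weight_const_def unit_ball_def enn2real_positive_iff)

text \<open>\<open>F\<close> is controlled only on the ball and may fail to be measurable outside.
  The density vanishes there, so \<open>F\<close> agrees with its cut-off almost everywhere with
  respect to \<open>nu \<alpha>\<close>.\<close>

lemma nn_integral_nu: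
  fixes F :: "complex ^ 'n \<Rightarrow> real"
  assumes F: "continuous_on (ball 0 1) F" "\<And>z. z \<in> ball 0 1 \<Longrightarrow> F z \<ge> 0"
  shows "(\<integral>\<^sup>+z. ennreal (F z) \<partial>nu \<alpha>) = ennreal (weight_const \<alpha> TYPE('n)) *
    (\<integral>\<^sup>+z. indicator (ball 0 1) z * ennreal ((1 - (norm z)\<^sup>2) powr \<alpha> * F z) \<partial>lborel)"
proof -
  define w where "w = weight_const \<alpha> TYPE('n)"
  have w: "w \<ge> 0" by (simp add: w_def weight_const_def)
  define D where "D = (\<lambda>z :: complex ^ 'n. indicator (ball 0 1) z * ennreal (w * (1 - (norm z)\<^sup>2) powr \<alpha>))"
  define G where "G = (\<lambda>z. indicator (ball 0 1) z * ennreal (F z))"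
  have D[measurable]: "D \<in> borel_measurable borel" unfolding D_def
    by (intro borel_measurable_indicator_continuous_on continuous_on_mult continuous_on_const continuous_on_ball_weight) simp
  have G[measurable]: "G \<in> borel_measurable borel" unfolding G_def
    by (intro borel_measurable_indicator_continuous_on F) simp
  have H: "(\<lambda>z. indicator (ball 0 1) z * ennreal ((1 - (norm z)\<^sup>2) powr \<alpha> * F z)) \<in> borel_measurable borel"
    by (intro borel_measurable_indicator_continuous_on continuous_on_mult continuous_on_ball_weight F) simp
  have nu: "nu \<alpha> = density lborel D" by (simp add: nu_def D_def unit_ball_def w_def)
  have "(\<integral>\<^sup>+z. ennreal (F z) \<partial>nu \<alpha>) = (\<integral>\<^sup>+z. G z \<partial>density lborel D)"
    unfolding nu by (intro nn_integral_cong_AE) (auto simp: AE_density D_def G_def indicator_def)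
  also have "\<dots> = (\<integral>\<^sup>+z. D z * G z \<partial>lborel)" by (intro nn_integral_density) auto
  also have "\<dots> = (\<integral>\<^sup>+z. ennreal w * (indicator (ball 0 1) z * ennreal ((1 - (norm z)\<^sup>2) powr \<alpha> * F z)) \<partial>lborel)"
    using w F(2) by (intro nn_integral_cong) (auto simp: D_def G_def indicator_def ennreal_mult[symmetric] mult.assoc)
  also have "\<dots> = ennreal w * (\<integral>\<^sup>+z. indicator (ball 0 1) z * ennreal ((1 - (norm z)\<^sup>2) powr \<alpha> * F z) \<partial>lborel)"
    using H by (intro nn_integral_cmult) simp
  finally show ?thesis by (simp add: w_def)
qed

text \<open>Since the weights are part of the pointwise hypothesis, only the two normalising
  constants remain to be exchanged. This covers both a change of weight and, with equal weights, a
  plain comparison of modulars.\<close>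

lemma nn_integral_nu_mono:
  fixes F G :: "complex ^ 'n \<Rightarrow> real"
  assumes F: "continuous_on (ball 0 1) F" "\<And>z. z \<in> ball 0 1 \<Longrightarrow> F z \<ge> 0"
    and G: "continuous_on (ball 0 1) G" "\<And>z. z \<in> ball 0 1 \<Longrightarrow> G z \<ge> 0"
    and \<alpha>: "\<alpha> > -1" and c: "c \<ge> 0"
    and le: "\<And>z. z \<in> ball 0 1 \<Longrightarrow>
      (1 - (norm z)\<^sup>2) powr \<beta> * F z \<le> c * ((1 - (norm z)\<^sup>2) powr \<alpha> * G z)"
  shows "(\<integral>\<^sup>+z. ennreal (F z) \<partial>nu \<beta>) \<le>
    ennreal (weight_const \<beta> TYPE('n) / weight_const \<alpha> TYPE('n) * c) * (\<integral>\<^sup>+z. ennreal (G z) \<partial>nu \<alpha>)"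
proof -
  define I where "I = (\<integral>\<^sup>+z. indicator (ball 0 1) z * ennreal ((1 - (norm z)\<^sup>2) powr \<alpha> * G z) \<partial>lborel)"
  let ?a = "weight_const \<alpha> TYPE('n)" and ?b = "weight_const \<beta> TYPE('n)"
  have a: "?a > 0" using \<alpha> by (rule weight_const_pos)
  have b: "?b \<ge> 0" by (simp add: weight_const_def)
  have [measurable]: "(\<lambda>z. indicator (ball 0 1) z * ennreal ((1 - (norm z)\<^sup>2) powr \<alpha> * G z)) \<in> borel_measurable borel"
    by (intro borel_measurable_indicator_continuous_on continuous_on_mult continuous_on_ball_weight G) simp
  have "(\<integral>\<^sup>+z. ennreal (F z) \<partial>nu \<beta>) = ennreal ?b *
      (\<integral>\<^sup>+z. indicator (ball 0 1) z * ennreal ((1 - (norm z)\<^sup>2) powr \<beta> * F z) \<partial>lborel)"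
    by (rule nn_integral_nu[OF F])
  also have "\<dots> \<le> ennreal ?b * (\<integral>\<^sup>+z. ennreal c *
      (indicator (ball 0 1) z * ennreal ((1 - (norm z)\<^sup>2) powr \<alpha> * G z)) \<partial>lborel)"
    using le G(2) c by (intro mult_left_mono nn_integral_mono)
      (auto simp: indicator_def ennreal_mult[symmetric] intro!: ennreal_leI)
  also have "\<dots> = ennreal ?b * (ennreal c * I)"
    unfolding I_def by (subst nn_integral_cmult) simp_all
  also have "\<dots> = ennreal (?b / ?a * c) * (ennreal ?a * I)"
    using a b c by (simp only: mult.assoc[symmetric] ennreal_mult'[symmetric]) 
      (simp add: ennreal_mult'[symmetric] field_simps)
  also have "ennreal ?a * I = (\<integral>\<^sup>+z. ennreal (G z) \<partial>nu \<alpha>)"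
    unfolding I_def by (rule nn_integral_nu[OF G, symmetric])
  finally show ?thesis .
qed

section \<open>Integrals of powers of the kernel\<close>

lemma ex_dyadic_bracket:
  fixes x :: real
  assumes "x \<ge> 1"
  obtains j :: nat where "2 ^ j \<le> x" "x < 2 ^ Suc j"
proof -
  define J where "J = (LEAST j. x < (2::real) ^ j)"
  have "\<exists>j. x < (2::real) ^ j" by (rule real_arch_pow) simp
  then have J: "x < 2 ^ J" unfolding J_def by (rule LeastI_ex)
  then obtain j where j: "J = Suc j" using assms by (cases J) auto
  then have "\<not> x < 2 ^ j" using not_less_Least[of j "\<lambda>j. x < (2::real) ^ j"] by (simp add: J_def)
  then show ?thesis using J j that[of j] by simp
qed

text \<open>The integral is summed over the dyadic shells \<open>2\<^sup>j u \<le> \<bar>1 - (1 - u) z\<^sub>k\<bar> < 2\<^sup>j\<^sup>+\<^sup>1 u\<close>.\<close>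
lemma kernel_power_integral_le:
  fixes k :: "'n::finite"
  assumes \<alpha>: "\<alpha> > -1" and s: "s \<ge> real CARD('n) + 2 + \<alpha>"
  obtains K where "K > 0" "\<And>u. 0 < u \<Longrightarrow> u \<le> 1 \<Longrightarrow>
    (\<integral>\<^sup>+z. indicator (ball 0 1) z * ennreal ((1 - (norm (z :: complex ^ 'n))\<^sup>2) powr \<alpha> *
        (u / cmod (1 - of_real (1 - u) * z $ k)) powr s) \<partial>lborel)
      \<le> ennreal (K * u powr (real CARD('n) + 1 + \<alpha>))"
proof -
  define N where "N = real CARD('n) + 1 + \<alpha>"
  have N: "N > 0" "s \<ge> N + 1" using \<alpha> s by (simp_all add: N_def)
  obtain K where K: "K > 0" "\<And>\<delta>. 0 < \<delta> \<Longrightarrow>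
    (\<integral>\<^sup>+z. indicator {z \<in> ball 0 1. cmod (1 - z $ k) < \<delta>} z * ennreal ((1 - (norm (z :: complex ^ 'n))\<^sup>2) powr \<alpha>) \<partial>lborel)
      \<le> ennreal (K * \<delta> powr N)"
    using weighted_cap_integral_le[OF \<alpha>] unfolding N_def by blast
  have "(\<integral>\<^sup>+z. indicator (ball 0 1) z * ennreal ((1 - (norm (z :: complex ^ 'n))\<^sup>2) powr \<alpha> *
        (u / cmod (1 - of_real (1 - u) * z $ k)) powr s) \<partial>lborel)
      \<le> ennreal (2 * K * 4 powr N * u powr N)" if u: "0 < u" "u \<le> 1" for u
  proof -
    define E where "E = (\<lambda>\<delta>. {z :: complex ^ 'n. z \<in> ball 0 1 \<and> cmod (1 - z $ k) < \<delta>})"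
    define G where "G = (\<lambda>\<delta> z. indicator (E \<delta>) z * ennreal ((1 - (norm z)\<^sup>2) powr \<alpha>))"
    have G[measurable]: "G \<delta> \<in> borel_measurable borel" for \<delta>
    proof -
      have "E \<delta> = ball 0 1 \<inter> {z. cmod (1 - z $ k) < \<delta>}" by (auto simp: E_def)
      also have "open \<dots>" by (intro open_Int open_ball open_Collect_less continuous_intros)
      finally have "open (E \<delta>)" .
      then show ?thesis unfolding G_def
        by (intro borel_measurable_indicator_continuous_on continuous_on_subset[OF continuous_on_ball_weight])
          (auto simp: E_def)
    qed
    \<comment> \<open>On the \<open>j\<close>-th shell the kernel power is at most
      \<open>(1 / 2 ^ j) powr s\<close>. The shell lies in the cap of size
      \<open>2 ^ (j + 2) * u\<close>, because replacing \<open>1 - u\<close> by 1 in the denominator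
      changes it by at most \<open>u\<close>.\<close>
    define T where "T = (\<lambda>j z. ennreal ((1 / 2 ^ j) powr s) * G (2 ^ (j + 2) * u) z)"
    have "indicator (ball 0 1) z * ennreal ((1 - (norm z)\<^sup>2) powr \<alpha> * (u / cmod (1 - of_real (1 - u) * z $ k)) powr s)
      \<le> (\<Sum>j. T j z)" for z
    proof (cases "z \<in> ball 0 1")
      case True
      define m where "m = cmod (1 - of_real (1 - u) * z $ k)"
      have zk: "cmod (z $ k) \<le> 1" using True Finite_Cartesian_Product.norm_nth_le[of z k] by simp
      have uz: "cmod (of_real (1 - u) * z $ k) \<le> 1 - u"
        using u zk unfolding norm_mult norm_of_real by (simp add: mult_left_le)
      then have m: "m \<ge> u" unfolding m_def
        using norm_triangle_ineq2[of 1 "of_real (1 - u) * z $ k"] by simp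
      then obtain j where j: "2 ^ j \<le> m / u" "m / u < 2 ^ Suc j"
        using ex_dyadic_bracket[of "m / u"] u by (auto simp: field_simps)
      have "cmod (1 - z $ k) \<le> m + cmod (of_real u * z $ k)" unfolding m_def
        using norm_triangle_ineq4[of "1 - of_real (1 - u) * z $ k" "of_real u * z $ k"]
        by (simp add: algebra_simps)
      also have "cmod (of_real u * z $ k) \<le> u" using u zk by (simp add: norm_mult mult_left_le)
      also have "m + u < 2 ^ (j + 2) * u"
      proof -
        have "m < 2 ^ Suc j * u" using j(2) u by (simp add: field_simps)
        moreover have "1 * u \<le> 2 ^ Suc j * u" using u by (intro mult_right_mono one_le_power) auto
        ultimately show ?thesis by simp
      qed
      finally have zE: "z \<in> E (2 ^ (j + 2) * u)" using True by (simp add: E_def)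
      have "u / m \<le> 1 / 2 ^ j" using j(1) u m by (simp add: field_simps)
      then have "(u / m) powr s \<le> (1 / 2 ^ j) powr s" using u m N by (intro powr_mono2) auto
      then have "(1 - (norm z)\<^sup>2) powr \<alpha> * (u / m) powr s \<le> (1 / 2 ^ j) powr s * (1 - (norm z)\<^sup>2) powr \<alpha>"
        by (subst mult.commute) (intro mult_right_mono, auto)
      then have "ennreal ((1 - (norm z)\<^sup>2) powr \<alpha> * (u / m) powr s) \<le> T j z"
        unfolding T_def G_def using zE by (simp add: ennreal_mult[symmetric] ennreal_leI)
      also have "\<dots> \<le> (\<Sum>j. T j z)"
        using sum_le_suminf[of "\<lambda>j. T j z" "{j}"] by simp
      finally show ?thesis using True by (simp add: m_def)
    qed simp
    then have "(\<integral>\<^sup>+z. indicator (ball 0 1) z * ennreal ((1 - (norm (z :: complex ^ 'n))\<^sup>2) powr \<alpha> *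
        (u / cmod (1 - of_real (1 - u) * z $ k)) powr s) \<partial>lborel) \<le> (\<integral>\<^sup>+z. (\<Sum>j. T j z) \<partial>lborel)"
      by (intro nn_integral_mono)
    also have "\<dots> = (\<Sum>j. \<integral>\<^sup>+z. T j z \<partial>lborel)"
      unfolding T_def by (intro nn_integral_suminf) simp
    also have "\<dots> \<le> (\<Sum>j. ennreal (K * 4 powr N * u powr N * (1 / 2) ^ j))"
    proof (intro suminf_le)
      fix j :: nat
      have "(\<integral>\<^sup>+z. T j z \<partial>lborel) = ennreal ((1 / 2 ^ j) powr s) * (\<integral>\<^sup>+z. G (2 ^ (j + 2) * u) z \<partial>lborel)"
        unfolding T_def by (simp add: nn_integral_cmult)
      also have "\<dots> \<le> ennreal ((1 / 2 ^ j) powr s) * ennreal (K * (2 ^ (j + 2) * u) powr N)"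
        unfolding G_def E_def using u by (intro mult_left_mono K(2)) auto
      also have "\<dots> = ennreal ((1 / 2 ^ j) powr s * (K * (2 ^ (j + 2) * u) powr N))"
        by (simp add: ennreal_mult K(1) less_imp_le)
      also have "\<dots> \<le> ennreal (K * 4 powr N * u powr N * (1 / 2) ^ j)"
      proof (rule ennreal_leI)
        have eq: "(2 ^ (j + 2) * u) powr N = (2 ^ j) powr N * 4 powr N * u powr N"
          using u by (simp add: power_add powr_mult mult.commute mult.left_commute)
        \<comment> \<open>The cap bound grows like \<open>(2 ^ j) powr N\<close>; the extra 1 in
          \<open>s \<ge> N + 1\<close> leaves the summable factor
          \<open>(1 / 2) ^ j\<close>.\<close>
        have "(1 / 2 ^ j) powr s \<le> (1 / 2 ^ j) powr (N + 1)"
          using N by (intro powr_mono') (auto simp: field_simps)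
        also have "\<dots> = (1 / 2 ^ j) powr N * (1 / 2) ^ j"
          by (simp add: powr_add power_divide)
        finally have "(1 / 2 ^ j) powr s * (K * (2 ^ (j + 2) * u) powr N) \<le>
            ((1 / 2 ^ j) powr N * (1 / 2) ^ j) * (K * (2 ^ (j + 2) * u) powr N)"
          using K(1) by (intro mult_right_mono) auto
        also note eq
        also have "((1 / 2 ^ j) powr N * (1 / 2) ^ j) * (K * ((2 ^ j) powr N * 4 powr N * u powr N)) =
            ((1 / 2 ^ j) powr N * (2 ^ j) powr N) * (K * 4 powr N * u powr N * (1 / 2) ^ j)"
          by simp
        also have "(1 / 2 ^ j) powr N * (2 ^ j) powr N = 1"
          by (simp add: powr_mult[symmetric])
        finally show "(1 / 2 ^ j) powr s * (K * (2 ^ (j + 2) * u) powr N) \<le> K * 4 powr N * u powr N * (1 / 2) ^ j"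
          unfolding eq by simp
      qed
      finally show "(\<integral>\<^sup>+z. T j z \<partial>lborel) \<le> ennreal (K * 4 powr N * u powr N * (1 / 2) ^ j)" .
    qed auto
    also have "\<dots> = ennreal (2 * K * 4 powr N * u powr N)"
    proof (rule suminf_ennreal_eq)
      show "(\<lambda>j. K * 4 powr N * u powr N * (1 / 2) ^ j) sums (2 * K * 4 powr N * u powr N)"
        using sums_mult[OF geometric_sums[of "1 / 2 :: real"], of "K * 4 powr N * u powr N"] by (simp add: mult_ac)
    qed (use K(1) in auto)
    finally show ?thesis .
  qed
  moreover have "2 * K * 4 powr N > 0" using K(1) by simp
  ultimately show ?thesis using that[of "2 * K * 4 powr N"] unfolding N_def by blast
qed

section \<open>Modulars on Bergman-Orlicz spaces\<close>

lemma holo_ball_iff: "holo_ball f \<longleftrightarrow> (\<forall>z\<in>ball 0 1. complex_differentiable f z)"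
  by (simp add: holo_ball_def complex_differentiable_def unit_ball_def)

lemma complex_differentiable_divide_const:
  assumes "complex_differentiable f z"
  shows "complex_differentiable (\<lambda>z. f z / c) z"
proof -
  obtain D where D: "(f has_derivative D) (at z)" "\<And>a v. D (a *s v) = a * D v"
    using assms unfolding complex_differentiable_def by blast
  have "((\<lambda>z. f z * inverse c) has_derivative (\<lambda>v. D v * inverse c)) (at z)"
    using D(1) by (rule has_derivative_mult_left)
  then show ?thesis unfolding complex_differentiable_def
    by (intro exI[of _ "\<lambda>v. D v * inverse c"]) (simp add: D(2) divide_inverse)
qed

section \<open>Inverse, modulars and Luxemburg scaling\<close>

context growth_type
begin

text \<open>Continuity makes the superlevel set closed, so its infimum is attained; comparing it
  with an exact preimage, supplied by surjectivity, excludes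
  \<open>\<Phi> (ginv \<Phi> y) > y\<close>.\<close>

lemma ginv:
  assumes "0 \<le> y"
  shows "0 \<le> ginv \<Phi> y" "\<Phi> (ginv \<Phi> y) = y" "\<And>t. 0 \<le> t \<Longrightarrow> y \<le> \<Phi> t \<Longrightarrow> ginv \<Phi> y \<le> t"
proof -
  define S where "S = {t. 0 \<le> t \<and> y \<le> \<Phi> t}"
  obtain t where t: "t \<ge> 0" "\<Phi> t = y" using surj assms by (metis atLeast_iff imageE)
  then have ne: "S \<noteq> {}" by (auto simp: S_def)
  have bdd: "bdd_below S" by (rule bdd_belowI[of _ 0]) (simp add: S_def)
  have "closed ({0..} \<inter> \<Phi> -` {y..})"
    using cont by (intro continuous_closed_preimage) auto
  also have "{0..} \<inter> \<Phi> -` {y..} = S" by (auto simp: S_def)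
  finally have "Inf S \<in> S" using ne bdd by (intro closed_contains_Inf)
  then have S: "0 \<le> ginv \<Phi> y" "y \<le> \<Phi> (ginv \<Phi> y)" by (auto simp: ginv_def S_def)
  show le: "ginv \<Phi> y \<le> t" if "0 \<le> t" "y \<le> \<Phi> t" for t
    unfolding ginv_def S_def[symmetric] using that bdd by (intro cInf_lower) (auto simp: S_def)
  show "0 \<le> ginv \<Phi> y" by fact
  show "\<Phi> (ginv \<Phi> y) = y" using S mono[OF S(1) le[OF t(1)]] t by simp
qed

lemma less_imp_less:
  assumes "0 \<le> y" "\<Phi> x < \<Phi> y"
  shows "x < y"
  using mono[of y x] assms by (cases "x < y") auto

lemma holo_ball_continuous_on: "holo_ball f \<Longrightarrow> continuous_on (ball 0 1) f"
  unfolding holo_ball_iff by (intro complex_differentiable_imp_continuous_on) blast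

lemma continuous_on_holo_ball_modular:
  assumes "holo_ball f" "r > 0"
  shows "continuous_on (ball 0 1) (\<lambda>z. \<Phi> (cmod (f z) / r))"
  using assms(2) by (intro continuous_on_compose2[OF cont] continuous_intros holo_ball_continuous_on[OF assms(1)]) auto

text \<open>The integrated form of the lower type; it lets a finite modular be brought below 1 by
  enlarging the denominator.\<close>

lemma modular_le_divide:
  fixes f :: "complex ^ 'n \<Rightarrow> complex"
  assumes f: "holo_ball f" and "r > 0" "t \<ge> 1" and \<alpha>: "\<alpha> > -1"
  shows "(\<integral>\<^sup>+z. ennreal (\<Phi> (cmod (f z) / (r * t))) \<partial>nu \<alpha>) \<le>
    ennreal (A * t powr - p) * (\<integral>\<^sup>+z. ennreal (\<Phi> (cmod (f z) / r)) \<partial>nu \<alpha>)"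
proof -
  have "(\<integral>\<^sup>+z. ennreal (\<Phi> (cmod (f z) / (r * t))) \<partial>nu \<alpha>) \<le>
      ennreal (weight_const \<alpha> TYPE('n) / weight_const \<alpha> TYPE('n) * (A * t powr - p)) *
      (\<integral>\<^sup>+z. ennreal (\<Phi> (cmod (f z) / r)) \<partial>nu \<alpha>)"
  proof (rule nn_integral_nu_mono)
    fix z :: "complex ^ 'n"
    have "\<Phi> (cmod (f z) / r * (1 / t)) \<le> A * (1 / t) powr p * \<Phi> (cmod (f z) / r)"
      using assms by (intro lower) auto
    then have "\<Phi> (cmod (f z) / (r * t)) \<le> A * t powr - p * \<Phi> (cmod (f z) / r)"
      using assms by (simp add: powr_divide powr_minus field_simps)
    then show "(1 - (norm z)\<^sup>2) powr \<alpha> * \<Phi> (cmod (f z) / (r * t)) \<le>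
        A * t powr - p * ((1 - (norm z)\<^sup>2) powr \<alpha> * \<Phi> (cmod (f z) / r))"
      by (subst mult.left_commute) (intro mult_left_mono, auto)
  qed (use assms A in \<open>auto intro!: continuous_on_holo_ball_modular nonneg\<close>)
  then show ?thesis using weight_const_pos[OF \<alpha>, where 'n='n] by simp
qed

lemma modular_le_mult:
  fixes f :: "complex ^ 'n \<Rightarrow> complex"
  assumes f: "holo_ball f" and "r > 0" "t \<ge> 1" and \<alpha>: "\<alpha> > -1"
  shows "(\<integral>\<^sup>+z. ennreal (\<Phi> (cmod (f z) / r)) \<partial>nu \<alpha>) \<le>
    ennreal (A * t powr q) * (\<integral>\<^sup>+z. ennreal (\<Phi> (cmod (f z) / (r * t))) \<partial>nu \<alpha>)"
proof -
  have "(\<integral>\<^sup>+z. ennreal (\<Phi> (cmod (f z) / r)) \<partial>nu \<alpha>) \<le>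
      ennreal (weight_const \<alpha> TYPE('n) / weight_const \<alpha> TYPE('n) * (A * t powr q)) *
      (\<integral>\<^sup>+z. ennreal (\<Phi> (cmod (f z) / (r * t))) \<partial>nu \<alpha>)"
  proof (rule nn_integral_nu_mono)
    fix z :: "complex ^ 'n"
    have "\<Phi> (cmod (f z) / (r * t) * t) \<le> A * t powr q * \<Phi> (cmod (f z) / (r * t))"
      using assms by (intro upper) auto
    then have "\<Phi> (cmod (f z) / r) \<le> A * t powr q * \<Phi> (cmod (f z) / (r * t))"
      using assms by simp
    then show "(1 - (norm z)\<^sup>2) powr \<alpha> * \<Phi> (cmod (f z) / r) \<le>
        A * t powr q * ((1 - (norm z)\<^sup>2) powr \<alpha> * \<Phi> (cmod (f z) / (r * t)))"
      by (subst mult.left_commute) (intro mult_left_mono, auto)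
  qed (use assms A in \<open>auto intro!: continuous_on_holo_ball_modular nonneg\<close>)
  then show ?thesis using weight_const_pos[OF \<alpha>, where 'n='n] by simp
qed

text \<open>\<open>R\<close> depends neither on \<open>f\<close> nor on \<open>r\<close>, so a
  uniform bound on modulars becomes a uniform bound on Luxemburg norms.\<close>

lemma ex_modular_scale:
  fixes X :: real
  assumes "X \<ge> 0" and \<alpha>: "\<alpha> > -1"
  obtains R where "R \<ge> 1"
    "\<And>(f :: complex ^ 'n \<Rightarrow> complex) r. holo_ball f \<Longrightarrow> r > 0 \<Longrightarrow>
      (\<integral>\<^sup>+z. ennreal (\<Phi> (cmod (f z) / r)) \<partial>nu \<alpha>) \<le> ennreal X \<Longrightarrow>
      (\<integral>\<^sup>+z. ennreal (\<Phi> (cmod (f z) / (r * R))) \<partial>nu \<alpha>) \<le> 1"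
proof -
  \<comment> \<open>Gives \<open>A * R powr - p * X = A * X / (A * X + 1)\<close>; the added 1 also
    ensures \<open>R \<ge> 1\<close> and covers \<open>X = 0\<close>.\<close>
  define R where "R = (A * X + 1) powr (1 / p)"
  have AX: "A * X \<ge> 0" using A assms by simp
  have R: "R \<ge> 1" unfolding R_def using AX p by (intro ge_one_powr_ge_zero) auto
  have "R powr - p = 1 / (A * X + 1)"
    using p AX by (simp add: R_def powr_powr powr_minus field_simps)
  then have "A * R powr - p * X = A * X / (A * X + 1)" by simp
  then have *: "A * R powr - p * X \<le> 1" using AX by (simp add: divide_le_eq_1)
  show ?thesis
  proof (rule that[OF R])
    fix f :: "complex ^ 'n \<Rightarrow> complex" and r :: real
    assume f: "holo_ball f" "r > 0" and X: "(\<integral>\<^sup>+z. ennreal (\<Phi> (cmod (f z) / r)) \<partial>nu \<alpha>) \<le> ennreal X"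
    have "(\<integral>\<^sup>+z. ennreal (\<Phi> (cmod (f z) / (r * R))) \<partial>nu \<alpha>) \<le>
        ennreal (A * R powr - p) * (\<integral>\<^sup>+z. ennreal (\<Phi> (cmod (f z) / r)) \<partial>nu \<alpha>)"
      using f R \<alpha> by (intro modular_le_divide)
    also have "\<dots> \<le> ennreal (A * R powr - p) * ennreal X"
      using X by (intro mult_left_mono) auto
    also have "\<dots> = ennreal (A * R powr - p * X)" using A assms by (intro ennreal_mult[symmetric]) auto
    also have "\<dots> \<le> 1" using * by (simp add: ennreal_le_1)
    finally show "(\<integral>\<^sup>+z. ennreal (\<Phi> (cmod (f z) / (r * R))) \<partial>nu \<alpha>) \<le> 1" .
  qed
qed

text \<open>Membership is defined at scale 1 while the Luxemburg norm involves every scale; the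
  upper type transfers finiteness to smaller scales, the lower type to larger ones.\<close>

lemma bergman_orlicz_iff:
  assumes f: "holo_ball f" and r: "r > 0" and \<alpha>: "\<alpha> > -1"
  shows "f \<in> bergman_orlicz \<Phi> \<alpha> \<longleftrightarrow> (\<integral>\<^sup>+z. ennreal (\<Phi> (cmod (f z) / r)) \<partial>nu \<alpha>) < \<infinity>"
proof -
  have *: "(\<integral>\<^sup>+z. ennreal (\<Phi> (cmod (f z) / s)) \<partial>nu \<alpha>) < \<infinity>"
    if "(\<integral>\<^sup>+z. ennreal (\<Phi> (cmod (f z) / t)) \<partial>nu \<alpha>) < \<infinity>" "s > 0" "t > 0" for s t
  proof (cases "s \<le> t")
    case True
    then have "(\<integral>\<^sup>+z. ennreal (\<Phi> (cmod (f z) / s)) \<partial>nu \<alpha>) \<le>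
        ennreal (A * (t / s) powr q) * (\<integral>\<^sup>+z. ennreal (\<Phi> (cmod (f z) / (s * (t / s)))) \<partial>nu \<alpha>)"
      using that f \<alpha> by (intro modular_le_mult) auto
    also have "\<dots> < \<infinity>" using that by (simp add: ennreal_mult_less_top)
    finally show ?thesis .
  next
    case False
    then have "(\<integral>\<^sup>+z. ennreal (\<Phi> (cmod (f z) / (t * (s / t)))) \<partial>nu \<alpha>) \<le>
        ennreal (A * (s / t) powr - p) * (\<integral>\<^sup>+z. ennreal (\<Phi> (cmod (f z) / t)) \<partial>nu \<alpha>)"
      using that f \<alpha> by (intro modular_le_divide) auto
    also have "\<dots> < \<infinity>" using that by (simp add: ennreal_mult_less_top)
    finally show ?thesis using that by simp
  qed
  show ?thesis using *[of r 1] *[of 1 r] f r by (auto simp: bergman_orlicz_def)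
qed

text \<open>Shows that the set whose infimum is the Luxemburg norm is nonempty; the infimum of an
  empty set would carry no information.\<close>

lemma ex_modular_le_1:
  fixes f :: "complex ^ 'n \<Rightarrow> complex"
  assumes f: "f \<in> bergman_orlicz \<Phi> \<alpha>" and \<alpha>: "\<alpha> > -1"
  obtains r where "r > 0" "(\<integral>\<^sup>+z. ennreal (\<Phi> (cmod (f z) / r)) \<partial>nu \<alpha>) \<le> 1"
proof -
  define I where "I = (\<integral>\<^sup>+z. ennreal (\<Phi> (cmod (f z) / 1)) \<partial>nu \<alpha>)"
  have "I < \<infinity>" using f by (simp add: I_def bergman_orlicz_def)
  then have I: "I = ennreal (enn2real I)" by (simp add: less_top)
  obtain R where "R \<ge> 1" "\<And>(f :: complex ^ 'n \<Rightarrow> complex) r. holo_ball f \<Longrightarrow> r > 0 \<Longrightarrow>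
      (\<integral>\<^sup>+z. ennreal (\<Phi> (cmod (f z) / r)) \<partial>nu \<alpha>) \<le> ennreal (enn2real I) \<Longrightarrow>
      (\<integral>\<^sup>+z. ennreal (\<Phi> (cmod (f z) / (r * R))) \<partial>nu \<alpha>) \<le> 1"
    using ex_modular_scale[OF enn2real_nonneg \<alpha>, of I] by metis
  from this(1) this(2)[of f 1] f I show ?thesis
    by (intro that[of "1 * R"]) (auto simp: bergman_orlicz_def I_def)
qed

text \<open>Dividing by \<open>r\<close> preserves holomorphy, so the unnormalised bound applies to
  \<open>f / r\<close>; the normalising constant of \<open>nu \<alpha>\<close> is moved into
  \<open>C\<close>.\<close>

lemma pointwise_bound_nu:
  assumes \<alpha>: "\<alpha> > -1"
  obtains C where "C > 0"
    "\<And>f r z. holo_ball f \<Longrightarrow> r > 0 \<Longrightarrow> (\<integral>\<^sup>+z. ennreal (\<Phi> (cmod (f z) / r)) \<partial>nu \<alpha>) \<le> 1 \<Longrightarrow>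
       (z :: complex ^ 'n) \<in> ball 0 1 \<Longrightarrow>
       \<Phi> (cmod (f z) / r) \<le> C * (1 - norm z) powr - (real CARD('n) + 1 + \<alpha>)"
proof -
  obtain C where C: "C > 0"
    "\<And>f z. (\<And>z :: complex ^ 'n. z \<in> ball 0 1 \<Longrightarrow> complex_differentiable f z) \<Longrightarrow> z \<in> ball 0 1 \<Longrightarrow>
       ennreal (\<Phi> (cmod (f z))) \<le> ennreal (C * (1 - norm z) powr - (real CARD('n) + 1 + \<alpha>)) *
         (\<integral>\<^sup>+w. indicator (ball 0 1) w * ennreal ((1 - (norm w)\<^sup>2) powr \<alpha> * \<Phi> (cmod (f w))) \<partial>lborel)"
    using pointwise_bound by blast
  define w where "w = weight_const \<alpha> TYPE('n)"
  have w: "w > 0" unfolding w_def using \<alpha> by (rule weight_const_pos)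
  have "\<Phi> (cmod (f z) / r) \<le> C / w * (1 - norm z) powr - (real CARD('n) + 1 + \<alpha>)"
    if f: "holo_ball f" "r > 0" and le: "(\<integral>\<^sup>+z. ennreal (\<Phi> (cmod (f z) / r)) \<partial>nu \<alpha>) \<le> 1"
      and z: "(z :: complex ^ 'n) \<in> ball 0 1" for f r z
  proof -
    let ?e = "(1 - norm z) powr - (real CARD('n) + 1 + \<alpha>)"
    define I where "I = (\<integral>\<^sup>+w. indicator (ball 0 1) w * ennreal ((1 - (norm w)\<^sup>2) powr \<alpha> * \<Phi> (cmod (f w) / r)) \<partial>lborel)"
    have "ennreal w * I = (\<integral>\<^sup>+z. ennreal (\<Phi> (cmod (f z) / r)) \<partial>nu \<alpha>)"
      unfolding I_def w_def using f
      by (intro nn_integral_nu[symmetric] continuous_on_holo_ball_modular nonneg) auto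
    then have I: "ennreal w * I \<le> 1" using le by simp
    have "complex_differentiable (\<lambda>z. f z / of_real r) z" if "z \<in> ball 0 1" for z
      using f(1) that unfolding holo_ball_iff by (intro complex_differentiable_divide_const) blast
    from C(2)[of "\<lambda>z. f z / of_real r" z, OF this z]
    have "ennreal (\<Phi> (cmod (f z) / r)) \<le> ennreal (C * ?e) * I"
      using f(2) by (simp add: I_def norm_divide)
    also have "\<dots> = ennreal (C / w * ?e) * (ennreal w * I)"
      using C(1) w by (simp add: mult.assoc[symmetric] ennreal_mult'[symmetric])
    also have "\<dots> \<le> ennreal (C / w * ?e) * 1" using I by (intro mult_left_mono) auto
    finally show ?thesis using C(1) w by (simp add: ennreal_le_iff)
  qed
  moreover have "C / w > 0" using C(1) w by simp
  ultimately show ?thesis using that[of "C / w"] by blast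
qed

text \<open>The kernel factor has modulus at most 1, so the lower type bounds the modular by
  \<open>u powr - N\<close> times an integral of a kernel power, and that integral is at most of
  order \<open>u powr N\<close>.\<close>

lemma ex_test_functions:
  fixes k :: "'n::finite"
  assumes \<alpha>: "\<alpha> > -1"
  obtains X \<kappa> where "X \<ge> 0"
    "\<And>u. 0 < u \<Longrightarrow> u \<le> 1 \<Longrightarrow> \<exists>f :: complex ^ 'n \<Rightarrow> complex. holo_ball f \<and>
       (\<integral>\<^sup>+z. ennreal (\<Phi> (cmod (f z))) \<partial>nu \<alpha>) \<le> ennreal X \<and>
       ginv \<Phi> (u powr - (real CARD('n) + 1 + \<alpha>)) \<le> 2 ^ \<kappa> * cmod (f (axis k (of_real (1 - u))))"
proof -
  define N where "N = real CARD('n) + 1 + \<alpha>"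
  \<comment> \<open>The lower type turns the power \<open>\<kappa>\<close> of the kernel into the
    exponent \<open>\<kappa> * p\<close>, which has to reach \<open>N + 1\<close> for the dyadic
    sum. As \<open>\<kappa>\<close> is a natural number, no branch of a complex power has to be
    chosen.\<close>
  define \<kappa> where "\<kappa> = nat \<lceil>(N + 1) / p\<rceil>"
  have \<kappa>: "real \<kappa> * p \<ge> real CARD('n) + 2 + \<alpha>"
  proof -
    have "(N + 1) / p \<le> real \<kappa>" unfolding \<kappa>_def by linarith
    then show ?thesis using p by (simp add: field_simps N_def)
  qed
  obtain K where K: "K > 0" "\<And>u. 0 < u \<Longrightarrow> u \<le> 1 \<Longrightarrow>
    (\<integral>\<^sup>+z. indicator (ball 0 1) z * ennreal ((1 - (norm (z :: complex ^ 'n))\<^sup>2) powr \<alpha> *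
        (u / cmod (1 - of_real (1 - u) * z $ k)) powr (real \<kappa> * p)) \<partial>lborel)
      \<le> ennreal (K * u powr N)"
    using kernel_power_integral_le[OF \<alpha> \<kappa>, of k] unfolding N_def by blast
  define w where "w = weight_const \<alpha> TYPE('n)"
  have w: "w > 0" unfolding w_def using \<alpha> by (rule weight_const_pos)
  have "\<exists>f :: complex ^ 'n \<Rightarrow> complex. holo_ball f \<and>
       (\<integral>\<^sup>+z. ennreal (\<Phi> (cmod (f z))) \<partial>nu \<alpha>) \<le> ennreal (w * A * K) \<and>
       ginv \<Phi> (u powr - N) \<le> 2 ^ \<kappa> * cmod (f (axis k (of_real (1 - u))))"
    if u: "0 < u" "u \<le> 1" for u
  proof (intro exI conjI)
    define l where "l = ginv \<Phi> (u powr - N)"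
    have l: "l \<ge> 0" "\<Phi> l = u powr - N" using ginv[of "u powr - N"] by (simp_all add: l_def)
    define m where "m = (\<lambda>z :: complex ^ 'n. 1 - of_real (1 - u) * z $ k)"
    define f where "f = (\<lambda>z. of_real l * (of_real u / m z) ^ \<kappa>)"
    have m: "cmod (m z) \<ge> u" if "z \<in> ball 0 1" for z
    proof -
      have "cmod (z $ k) \<le> 1" using that Finite_Cartesian_Product.norm_nth_le[of z k] by simp
      then have "cmod (of_real (1 - u) * z $ k) \<le> 1 - u"
        using u unfolding norm_mult norm_of_real by (simp add: mult_left_le)
      then show ?thesis unfolding m_def
        using norm_triangle_ineq2[of 1 "of_real (1 - u) * z $ k"] by simp
    qed
    show f: "holo_ball f" unfolding holo_ball_iff
    proof
      fix z :: "complex ^ 'n" assume "z \<in> ball 0 1"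
      then have "m z \<noteq> 0" using m[of z] u by auto
      then have "((\<lambda>y. of_real l * (of_real u / y) ^ \<kappa>) has_field_derivative
          of_real l * (of_nat \<kappa> * (- of_real u / (m z)\<^sup>2) * (of_real u / m z) ^ (\<kappa> - 1))) (at (m z))"
        by (auto intro!: derivative_eq_intros simp: power2_eq_square)
      then obtain D where "((\<lambda>y. of_real l * (of_real u / y) ^ \<kappa>) has_derivative (\<lambda>y. D * y)) (at (m z))"
        unfolding has_field_derivative_def by blast
      moreover have "(m has_derivative (\<lambda>v. - (of_real (1 - u) * v $ k))) (at z)"
        unfolding m_def
        by (auto intro!: derivative_eq_intros bounded_linear_imp_has_derivative bounded_linear_vec_nth)
      ultimately have "(f has_derivative (\<lambda>v. D * - (of_real (1 - u) * v $ k))) (at z)"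
        unfolding f_def by (rule has_derivative_compose[rotated])
      then show "complex_differentiable f z" unfolding complex_differentiable_def
        by (intro exI[of _ "\<lambda>v. D * - (of_real (1 - u) * v $ k)"]) (simp add: algebra_simps)
    qed
    have \<Phi>f: "\<Phi> (cmod (f z)) \<le> A * u powr - N * (u / cmod (m z)) powr (real \<kappa> * p)" if z: "z \<in> ball 0 1" for z
    proof -
      have "cmod (m z) > 0" using m[OF z] u by linarith
      then have pos: "0 < u / cmod (m z)" "u / cmod (m z) \<le> 1" using m[OF z] u by simp_all
      have "cmod (f z) = l * (u / cmod (m z)) ^ \<kappa>"
        using l u by (simp add: f_def norm_mult norm_power norm_divide)
      also have "\<Phi> \<dots> \<le> A * ((u / cmod (m z)) ^ \<kappa>) powr p * \<Phi> l"
        using pos l by (intro lower zero_less_power power_le_one) auto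
      also have "((u / cmod (m z)) ^ \<kappa>) powr p = (u / cmod (m z)) powr (real \<kappa> * p)"
        using pos by (simp add: powr_realpow[symmetric] powr_powr)
      finally show ?thesis by (simp add: l mult_ac)
    qed
    have "(\<integral>\<^sup>+z. ennreal (\<Phi> (cmod (f z))) \<partial>nu \<alpha>) = ennreal w *
        (\<integral>\<^sup>+z. indicator (ball 0 1) z * ennreal ((1 - (norm z)\<^sup>2) powr \<alpha> * \<Phi> (cmod (f z))) \<partial>lborel)"
      unfolding w_def using continuous_on_holo_ball_modular[OF f, of 1]
      by (intro nn_integral_nu nonneg) auto
    also have "\<dots> \<le> ennreal w * (\<integral>\<^sup>+z. ennreal (A * u powr - N) * (indicator (ball 0 1) z * ennreal ((1 - (norm z)\<^sup>2) powr \<alpha> *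
        (u / cmod (m z)) powr (real \<kappa> * p))) \<partial>lborel)"
    proof (intro mult_left_mono nn_integral_mono)
      fix z :: "complex ^ 'n"
      show "indicator (ball 0 1) z * ennreal ((1 - (norm z)\<^sup>2) powr \<alpha> * \<Phi> (cmod (f z))) \<le>
        ennreal (A * u powr - N) * (indicator (ball 0 1) z * ennreal ((1 - (norm z)\<^sup>2) powr \<alpha> *
        (u / cmod (m z)) powr (real \<kappa> * p)))"
      proof (cases "z \<in> ball 0 1")
        case True
        have "(1 - (norm z)\<^sup>2) powr \<alpha> * \<Phi> (cmod (f z)) \<le>
            (1 - (norm z)\<^sup>2) powr \<alpha> * (A * u powr - N * (u / cmod (m z)) powr (real \<kappa> * p))"
          using \<Phi>f[OF True] by (intro mult_left_mono) auto
        then show ?thesis using True A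
          by (simp add: ennreal_mult'[symmetric] mult_ac ennreal_leI)
      qed simp
    qed auto
    also have "\<dots> = ennreal w * (ennreal (A * u powr - N) * (\<integral>\<^sup>+z. indicator (ball 0 1) z * ennreal ((1 - (norm z)\<^sup>2) powr \<alpha> *
        (u / cmod (m z)) powr (real \<kappa> * p)) \<partial>lborel))"
    proof -
      have "continuous_on (ball 0 1) (\<lambda>z. (1 - (norm z)\<^sup>2) powr \<alpha> * (u / cmod (m z)) powr (real \<kappa> * p))"
        using m u unfolding m_def
        by (intro continuous_on_mult continuous_on_ball_weight continuous_intros) (fastforce simp: m_def)+
      then have "(\<lambda>z. indicator (ball 0 1) z * ennreal ((1 - (norm z)\<^sup>2) powr \<alpha> *
        (u / cmod (m z)) powr (real \<kappa> * p))) \<in> borel_measurable borel"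
        by (intro borel_measurable_indicator_continuous_on) auto
      then show ?thesis by (subst nn_integral_cmult) auto
    qed
    also have "\<dots> \<le> ennreal w * (ennreal (A * u powr - N) * ennreal (K * u powr N))"
      unfolding m_def using u by (intro mult_left_mono K(2)) auto
    also have "\<dots> = ennreal (w * (A * u powr - N * (K * u powr N)))"
      using w A K(1) by (simp add: ennreal_mult)
    also have "w * (A * u powr - N * (K * u powr N)) = w * A * K"
      using u by (simp add: powr_minus)
    finally show "(\<integral>\<^sup>+z. ennreal (\<Phi> (cmod (f z))) \<partial>nu \<alpha>) \<le> ennreal (w * A * K)" .
    \<comment> \<open>At this point the denominator is \<open>u * (2 - u)\<close>, so the kernel
      equals \<open>1 / (2 - u) \<ge> 1 / 2\<close>; hence the factor
      \<open>2 ^ \<kappa>\<close>.\<close>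
    have "m (axis k (of_real (1 - u))) = of_real (1 - (1 - u) * (1 - u))"
      by (simp add: m_def)
    also have "1 - (1 - u) * (1 - u) = u * (2 - u)" by (simp add: algebra_simps)
    finally have "cmod (f (axis k (of_real (1 - u)))) = l * (u / (u * (2 - u))) ^ \<kappa>"
      using l u by (simp add: f_def norm_mult norm_power norm_divide del: of_real_mult of_real_diff)
    also have "u / (u * (2 - u)) = 1 / (2 - u)" using u by simp
    also have "2 ^ \<kappa> * (l * (1 / (2 - u)) ^ \<kappa>) = l * (2 / (2 - u)) ^ \<kappa>"
      by (simp add: power_divide)
    finally have "2 ^ \<kappa> * cmod (f (axis k (of_real (1 - u)))) = l * (2 / (2 - u)) ^ \<kappa>" .
    moreover have "1 \<le> (2 / (2 - u)) ^ \<kappa>" using u by (intro one_le_power) (simp add: field_simps)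
    then have "l * 1 \<le> l * (2 / (2 - u)) ^ \<kappa>" using l by (intro mult_left_mono)
    ultimately show "ginv \<Phi> (u powr - N) \<le> 2 ^ \<kappa> * cmod (f (axis k (of_real (1 - u))))"
      by (simp add: l_def)
  qed
  moreover have "w * A * K \<ge> 0" using w A K(1) by simp
  ultimately show ?thesis using that[of "w * A * K" \<kappa>] unfolding N_def by blast
qed

end

text \<open>Each class prescribes one of the two power bounds; the other one, with exponent 1, is
  the monotonicity of \<open>\<Phi> t / t\<close>.\<close>

lemma L_U_imp_growth_type:
  assumes "\<Phi> \<in> L_class \<union> U_class"
  obtains p q A where "growth_type \<Phi> p q A"
proof -
  have growth: "growth_fun \<Phi>" using assms by (auto simp: L_class_def U_class_def)
  then have cont: "continuous_on {0..} \<Phi>" and mono: "\<And>x y. 0 \<le> x \<Longrightarrow> x \<le> y \<Longrightarrow> \<Phi> x \<le> \<Phi> y"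
    and surj: "\<Phi> ` {0..} = {0..}" and one: "\<Phi> 1 = 1"
    by (auto simp: growth_fun_def mono_on_def)
  obtain x where x: "x \<ge> 0" "\<Phi> x = 0" using surj by (metis atLeast_iff imageE order_refl)
  have nonneg: "\<Phi> y \<ge> 0" if "y \<ge> 0" for y using surj that by auto
  have zero: "\<Phi> 0 = 0" using mono[of 0 x] x nonneg[of 0] by simp
  show ?thesis
  proof (cases "\<Phi> \<in> U_class")
    case True
    then obtain q C where up: "\<And>s t. s > 0 \<Longrightarrow> t \<ge> 1 \<Longrightarrow> \<Phi> (s * t) \<le> C * t powr q * \<Phi> s"
      and ratio: "mono_on {0<..} (\<lambda>t. \<Phi> t / t)"
      unfolding U_class_def upper_type_def by blast
    \<comment> \<open>If \<open>\<Phi> s\<close> vanished for some \<open>s < 1\<close>, the upper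
      type would carry the zero up to \<open>\<Phi> 1 = 1\<close>.\<close>
    have pos: "\<Phi> s > 0" if s: "s > 0" for s
    proof (cases "s \<ge> 1")
      case True
      then show ?thesis using mono[of 1 s] one by simp
    next
      case False
      then have "\<Phi> (s * (1 / s)) \<le> C * (1 / s) powr q * \<Phi> s" using s by (intro up) auto
      then have "\<Phi> s \<noteq> 0" using s one by auto
      then show ?thesis using nonneg[of s] s by simp
    qed
    have "growth_type \<Phi> 1 q (max 1 C)"
    proof
      fix s t :: real
      show "\<Phi> (s * t) \<le> max 1 C * t powr 1 * \<Phi> s" if "0 \<le> s" "0 < t" "t \<le> 1"
      proof (cases "s = 0")
        case False
        then have "\<Phi> (s * t) / (s * t) \<le> \<Phi> s / s"
          using that by (intro mono_onD[OF ratio]) (auto simp: mult_left_le)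
        then have "\<Phi> (s * t) \<le> 1 * (t * \<Phi> s)" using False that by (simp add: field_simps)
        also have "\<dots> \<le> max 1 C * (t * \<Phi> s)" using nonneg[of s] that by (intro mult_right_mono) auto
        finally show ?thesis using that by simp
      qed (simp add: zero)
      show "\<Phi> (s * t) \<le> max 1 C * t powr q * \<Phi> s" if "0 \<le> s" "1 \<le> t"
      proof (cases "s = 0")
        case False
        then have "\<Phi> (s * t) \<le> C * t powr q * \<Phi> s" using that by (intro up) auto
        also have "\<dots> \<le> max 1 C * t powr q * \<Phi> s" using nonneg[of s] that by (intro mult_right_mono) auto
        finally show ?thesis .
      qed (simp add: zero)
    qed (use cont mono surj zero pos in auto)
    then show ?thesis by (rule that)
  next
    case False
    then obtain p C where p: "p > 0"
      and low: "\<And>s t. s > 0 \<Longrightarrow> 0 < t \<Longrightarrow> t \<le> 1 \<Longrightarrow> \<Phi> (s * t) \<le> C * t powr p * \<Phi> s"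
      and ratio: "antimono_on {0<..} (\<lambda>t. \<Phi> t / t)"
      using assms unfolding L_class_def lower_type_def by blast
    have pos: "\<Phi> s > 0" if s: "s > 0" for s
    proof (cases "s \<ge> 1")
      case True
      then show ?thesis using mono[of 1 s] one by simp
    next
      case False
      then have "\<Phi> 1 / 1 \<le> \<Phi> s / s" using s by (intro monotone_onD[OF ratio]) auto
      then show ?thesis using s one by (simp add: field_simps)
    qed
    have "growth_type \<Phi> p 1 (max 1 C)"
    proof
      fix s t :: real
      show "\<Phi> (s * t) \<le> max 1 C * t powr 1 * \<Phi> s" if "0 \<le> s" "1 \<le> t"
      proof (cases "s = 0")
        case False
        then have "s * 1 \<le> s * t" using that by (intro mult_left_mono) auto
        then have "\<Phi> (s * t) / (s * t) \<le> \<Phi> s / s"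
          using that False by (intro monotone_onD[OF ratio]) auto
        then have "\<Phi> (s * t) \<le> 1 * (t * \<Phi> s)" using False that by (simp add: field_simps)
        also have "\<dots> \<le> max 1 C * (t * \<Phi> s)" using nonneg[of s] that by (intro mult_right_mono) auto
        finally show ?thesis using that by simp
      qed (simp add: zero)
      show "\<Phi> (s * t) \<le> max 1 C * t powr p * \<Phi> s" if "0 \<le> s" "0 < t" "t \<le> 1"
      proof (cases "s = 0")
        case False
        then have "\<Phi> (s * t) \<le> C * t powr p * \<Phi> s" using that by (intro low) auto
        also have "\<dots> \<le> max 1 C * t powr p * \<Phi> s" using nonneg[of s] that by (intro mult_right_mono) auto
        finally show ?thesis .
      qed (simp add: zero)
    qed (use cont mono surj zero pos p in auto)
    then show ?thesis by (rule that)
  qed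
qed

section \<open>The embedding\<close>

text \<open>The two sides differ by a power of \<open>1 + norm z\<close>, which lies between 1 and
  2. The absolute value is there because the exponent will be \<open>\<alpha> - \<beta>\<close>, of
  either sign.\<close>

lemma one_minus_norm_powr_le:
  fixes z :: "'a::real_normed_vector"
  assumes "norm z < 1"
  shows "(1 - norm z) powr \<gamma> \<le> 2 powr \<bar>\<gamma>\<bar> * (1 - (norm z)\<^sup>2) powr \<gamma>"
proof -
  have "1 - (norm z)\<^sup>2 = (1 - norm z) * (1 + norm z)"
    by (simp add: power2_eq_square algebra_simps)
  then have "(1 - (norm z)\<^sup>2) powr \<gamma> = ((1 - norm z) * (1 + norm z)) powr \<gamma>"
    by (rule arg_cong)
  also have "\<dots> = (1 - norm z) powr \<gamma> * (1 + norm z) powr \<gamma>"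
    by (rule powr_mult)
  finally have "(1 + norm z) powr - \<gamma> * (1 - (norm z)\<^sup>2) powr \<gamma> =
      (1 - norm z) powr \<gamma> * ((1 + norm z) powr - \<gamma> * (1 + norm z) powr \<gamma>)"
    by simp
  also have "(1 + norm z) powr - \<gamma> * (1 + norm z) powr \<gamma> = 1"
    using norm_ge_zero[of z] unfolding powr_add[symmetric] by (simp add: add_nonneg_eq_0_iff)
  finally have "(1 - norm z) powr \<gamma> = (1 + norm z) powr - \<gamma> * (1 - (norm z)\<^sup>2) powr \<gamma>" by simp
  also have "(1 + norm z) powr - \<gamma> \<le> 2 powr \<bar>\<gamma>\<bar>"
  proof (rule order_trans)
    show "(1 + norm z) powr - \<gamma> \<le> (1 + norm z) powr \<bar>\<gamma>\<bar>" by (intro powr_mono) auto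
    show "(1 + norm z) powr \<bar>\<gamma>\<bar> \<le> 2 powr \<bar>\<gamma>\<bar>" using assms by (intro powr_mono2) auto
  qed
  finally show ?thesis by (simp add: mult_right_mono)
qed

text \<open>At a point \<open>z\<close> the values of \<open>f\<close> lie below \<open>\<Phi>1\<^sup>-\<^sup>1 (t\<^sup>N)\<close> with \<open>t\<close> comparable to
  \<open>1 / (1 - \<bar>z\<bar>)\<close>, so monotonicity of \<open>\<Phi>2 / \<Phi>1\<close> bounds \<open>\<Phi>2 (\<bar>f z\<bar>)\<close> by \<open>(1 - \<bar>z\<bar>\<^sup>2)\<^sup>\<alpha>\<^sup>-\<^sup>\<beta> \<Phi>1 (\<bar>f z\<bar>)\<close>.\<close>
lemma modular_embedding:
  assumes \<Phi>1: "growth_type \<Phi>1 p1 q1 A1" and \<Phi>2: "growth_type \<Phi>2 p2 q2 A2"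
    and \<alpha>: "\<alpha> > -1"
    and ratio: "mono_on {0<..} (\<lambda>t. \<Phi>2 t / \<Phi>1 t)"
    and C: "C > 0" "\<And>t. t \<ge> 1 \<Longrightarrow> \<Phi>2 (ginv \<Phi>1 (t powr (real CARD('n) + 1 + \<alpha>))) \<le> C * t powr (real CARD('n) + 1 + \<beta>)"
  obtains B where "B \<ge> 0"
    "\<And>(f :: complex ^ 'n \<Rightarrow> complex) r. holo_ball f \<Longrightarrow> r > 0 \<Longrightarrow>
      (\<integral>\<^sup>+z. ennreal (\<Phi>1 (cmod (f z) / r)) \<partial>nu \<alpha>) \<le> 1 \<Longrightarrow>
      (\<integral>\<^sup>+z. ennreal (\<Phi>2 (cmod (f z) / r)) \<partial>nu \<beta>) \<le> ennreal B"
proof -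
  interpret \<Phi>1: growth_type \<Phi>1 p1 q1 A1 by fact
  interpret \<Phi>2: growth_type \<Phi>2 p2 q2 A2 by fact
  define N M where "N = real CARD('n) + 1 + \<alpha>" and "M = real CARD('n) + 1 + \<beta>"
  have N: "N > 0" using \<alpha> by (simp add: N_def)
  obtain C1 where C1: "C1 > 0"
    "\<And>f r z. holo_ball f \<Longrightarrow> r > 0 \<Longrightarrow> (\<integral>\<^sup>+z. ennreal (\<Phi>1 (cmod (f z) / r)) \<partial>nu \<alpha>) \<le> 1 \<Longrightarrow>
       (z :: complex ^ 'n) \<in> ball 0 1 \<Longrightarrow>
       \<Phi>1 (cmod (f z) / r) \<le> C1 * (1 - norm z) powr - N"
    using \<Phi>1.pointwise_bound_nu[OF \<alpha>, where 'n='n, folded N_def] by blast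
  \<comment> \<open>Makes \<open>(a / y) powr N\<close> equal to
    \<open>(C1 + 1) * y powr - N\<close>, strictly above the pointwise bound. Since
    \<open>\<Phi>1\<close> may be constant on intervals, it takes a strict inequality of values to
    order \<open>u\<close> and \<open>v\<close>.\<close>
  define a where "a = (C1 + 1) powr (1 / N)"
  have a: "a \<ge> 1" unfolding a_def using C1(1) N by (intro ge_one_powr_ge_zero) auto
  have aN: "a powr N = C1 + 1" using N C1(1) by (simp add: a_def powr_powr)
  define c where "c = C * a powr (\<beta> - \<alpha>) * 2 powr \<bar>\<alpha> - \<beta>\<bar>"
  have c: "c \<ge> 0" using C(1) by (simp add: c_def)
  define B where "B = weight_const \<beta> TYPE('n) / weight_const \<alpha> TYPE('n) * c"
  have "B \<ge> 0" using c by (simp add: B_def weight_const_def)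
  moreover have "(\<integral>\<^sup>+z. ennreal (\<Phi>2 (cmod (f z) / r)) \<partial>nu \<beta>) \<le> ennreal B"
    if f: "holo_ball f" "r > 0" and le: "(\<integral>\<^sup>+z. ennreal (\<Phi>1 (cmod (f z) / r)) \<partial>nu \<alpha>) \<le> 1"
    for f :: "complex ^ 'n \<Rightarrow> complex" and r
  proof -
    have "(\<integral>\<^sup>+z. ennreal (\<Phi>2 (cmod (f z) / r)) \<partial>nu \<beta>) \<le>
        ennreal B * (\<integral>\<^sup>+z. ennreal (\<Phi>1 (cmod (f z) / r)) \<partial>nu \<alpha>)"
      unfolding B_def
    proof (rule nn_integral_nu_mono)
      fix z :: "complex ^ 'n" assume z: "z \<in> ball 0 1"
      define u where "u = cmod (f z) / r"
      define y where "y = 1 - norm z"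
      have y: "0 < y" "y \<le> 1" using z by (auto simp: y_def)
      have \<Phi>2_le: "\<Phi>2 u \<le> C * a powr (\<beta> - \<alpha>) * y powr (\<alpha> - \<beta>) * \<Phi>1 u"
      proof (cases "u = 0")
        case False
        then have u: "u > 0" using f(2) by (simp add: u_def)
        define t where "t = a / y"
        have t: "t \<ge> 1" using a y by (simp add: t_def le_divide_eq)
        have tN: "t powr N = (C1 + 1) * y powr - N"
          using a y by (simp add: t_def powr_divide aN powr_minus_divide)
        define v where "v = ginv \<Phi>1 (t powr N)"
        have v: "0 \<le> v" "\<Phi>1 v = t powr N" using \<Phi>1.ginv[of "t powr N"] by (simp_all add: v_def)
        have "\<Phi>1 u \<le> C1 * y powr - N" using C1(2)[OF f le z] by (simp add: u_def y_def)
        also have "\<dots> < t powr N" unfolding tN using y by (intro mult_strict_right_mono) auto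
        finally have "u < v" using v \<Phi>1.less_imp_less[of v u] by simp
        then have "\<Phi>2 u / \<Phi>1 u \<le> \<Phi>2 v / \<Phi>1 v" using u by (intro mono_onD[OF ratio]) auto
        also have "\<dots> \<le> C * t powr M / t powr N"
          unfolding v(2) unfolding v_def using C(2)[OF t] by (intro divide_right_mono) (auto simp: N_def M_def)
        \<comment> \<open>Here \<open>M - N = \<beta> - \<alpha>\<close>: up to constants the
          quotient of the two powers is the quotient of the two weights at \<open>z\<close>.\<close>
        also have "\<dots> = C * t powr (\<beta> - \<alpha>)"
          unfolding times_divide_eq_right[symmetric] powr_diff[symmetric] by (simp add: N_def M_def)
        also have "t powr (\<beta> - \<alpha>) = a powr (\<beta> - \<alpha>) * y powr (\<alpha> - \<beta>)"
          using a y powr_minus_divide[of y "\<beta> - \<alpha>"] by (simp add: t_def powr_divide)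
        finally show ?thesis using \<Phi>1.pos[OF u] by (simp add: pos_divide_le_eq mult.assoc)
      qed (simp add: \<Phi>1.zero \<Phi>2.zero)
      let ?W = "\<lambda>\<gamma>. (1 - (norm z)\<^sup>2) powr \<gamma>"
      have "y powr (\<alpha> - \<beta>) \<le> 2 powr \<bar>\<alpha> - \<beta>\<bar> * ?W (\<alpha> - \<beta>)"
        unfolding y_def using z by (intro one_minus_norm_powr_le) simp
      then have "C * a powr (\<beta> - \<alpha>) * y powr (\<alpha> - \<beta>) * \<Phi>1 u \<le>
          C * a powr (\<beta> - \<alpha>) * (2 powr \<bar>\<alpha> - \<beta>\<bar> * ?W (\<alpha> - \<beta>)) * \<Phi>1 u"
        using C(1) f(2) by (intro mult_right_mono mult_left_mono \<Phi>1.nonneg) (auto simp: u_def)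
      with \<Phi>2_le have "\<Phi>2 u \<le> c * ?W (\<alpha> - \<beta>) * \<Phi>1 u" by (simp add: c_def mult.assoc)
      then have "?W \<beta> * \<Phi>2 u \<le> ?W \<beta> * (c * ?W (\<alpha> - \<beta>) * \<Phi>1 u)" by (intro mult_left_mono) auto
      also have "\<dots> = c * ((?W \<beta> * ?W (\<alpha> - \<beta>)) * \<Phi>1 u)" by simp
      also have "?W \<beta> * ?W (\<alpha> - \<beta>) = ?W \<alpha>" by (simp add: powr_add[symmetric])
      finally show "?W \<beta> * \<Phi>2 (cmod (f z) / r) \<le> c * (?W \<alpha> * \<Phi>1 (cmod (f z) / r))"
        by (simp add: u_def)
    qed (use f \<alpha> c in \<open>auto intro!: \<Phi>1.continuous_on_holo_ball_modular \<Phi>2.continuous_on_holo_ball_modular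
      \<Phi>1.nonneg \<Phi>2.nonneg\<close>)
    also have "\<dots> \<le> ennreal B * 1" using le by (intro mult_left_mono) auto
    finally show ?thesis by simp
  qed
  ultimately show ?thesis by (rule that)
qed

text \<open>The norm inequality speaks only about infima, so it is first turned into a modular bound
  for the test functions at one fixed scale \<open>\<Lambda>\<close>; the upper type of
  \<open>\<Phi>2\<close> then absorbs \<open>\<Lambda>\<close> and \<open>2 ^ \<kappa>\<close> into
  the constant.\<close>

lemma lux_embedding_imp_growth:
  assumes \<Phi>1: "growth_type \<Phi>1 p1 q1 A1" and \<Phi>2: "growth_type \<Phi>2 p2 q2 A2"
    and \<alpha>: "\<alpha> > -1" and \<beta>: "\<beta> > -1"
    and sub: "(bergman_orlicz \<Phi>1 \<alpha> :: (complex ^ 'n \<Rightarrow> complex) set) \<subseteq> bergman_orlicz \<Phi>2 \<beta>"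
    and C0: "C0 > 0" "\<And>f. f \<in> (bergman_orlicz \<Phi>1 \<alpha> :: (complex ^ 'n \<Rightarrow> complex) set) \<Longrightarrow>
      lux_norm \<Phi>2 \<beta> f \<le> C0 * lux_norm \<Phi>1 \<alpha> f"
  obtains C where "C > 0"
    "\<And>t. t \<ge> 1 \<Longrightarrow> \<Phi>2 (ginv \<Phi>1 (t powr (real CARD('n) + 1 + \<alpha>))) \<le> C * t powr (real CARD('n) + 1 + \<beta>)"
proof -
  interpret \<Phi>1: growth_type \<Phi>1 p1 q1 A1 by fact
  interpret \<Phi>2: growth_type \<Phi>2 p2 q2 A2 by fact
  define N M where "N = real CARD('n) + 1 + \<alpha>" and "M = real CARD('n) + 1 + \<beta>"
  define k where "k = (undefined :: 'n)"
  obtain X \<kappa> where X: "X \<ge> 0"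
    "\<And>u. 0 < u \<Longrightarrow> u \<le> 1 \<Longrightarrow> \<exists>f :: complex ^ 'n \<Rightarrow> complex. holo_ball f \<and>
       (\<integral>\<^sup>+z. ennreal (\<Phi>1 (cmod (f z))) \<partial>nu \<alpha>) \<le> ennreal X \<and>
       ginv \<Phi>1 (u powr - N) \<le> 2 ^ \<kappa> * cmod (f (axis k (of_real (1 - u))))"
    using \<Phi>1.ex_test_functions[OF \<alpha>, of k, folded N_def] by blast
  obtain R where R: "R \<ge> 1"
    "\<And>(f :: complex ^ 'n \<Rightarrow> complex) r. holo_ball f \<Longrightarrow> r > 0 \<Longrightarrow>
      (\<integral>\<^sup>+z. ennreal (\<Phi>1 (cmod (f z) / r)) \<partial>nu \<alpha>) \<le> ennreal X \<Longrightarrow>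
      (\<integral>\<^sup>+z. ennreal (\<Phi>1 (cmod (f z) / (r * R))) \<partial>nu \<alpha>) \<le> 1"
    using \<Phi>1.ex_modular_scale[OF X(1) \<alpha>, where 'n='n] by blast
  obtain C2 where C2: "C2 > 0"
    "\<And>f r z. holo_ball f \<Longrightarrow> r > 0 \<Longrightarrow> (\<integral>\<^sup>+z. ennreal (\<Phi>2 (cmod (f z) / r)) \<partial>nu \<beta>) \<le> 1 \<Longrightarrow>
       (z :: complex ^ 'n) \<in> ball 0 1 \<Longrightarrow>
       \<Phi>2 (cmod (f z) / r) \<le> C2 * (1 - norm z) powr - M"
    using \<Phi>2.pointwise_bound_nu[OF \<beta>, where 'n='n, folded M_def] by blast
  \<comment> \<open>The added 1 puts \<open>\<Lambda>\<close> strictly above \<open>Inf S2\<close>,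
    so an actual member of \<open>S2\<close> lies below it, and monotonicity passes the modular
    bound on to \<open>\<Lambda>\<close>.\<close>
  define \<Lambda> where "\<Lambda> = C0 * R + 1"
  have \<Lambda>: "\<Lambda> \<ge> 1" using C0(1) R(1) by (simp add: \<Lambda>_def)
  define C where "C = A2 * (\<Lambda> * 2 ^ \<kappa>) powr q2 * C2"
  have C: "C > 0" using \<Phi>2.A C2(1) \<Lambda> by (simp add: C_def)
  have "\<Phi>2 (ginv \<Phi>1 (t powr N)) \<le> C * t powr M" if t: "t \<ge> 1" for t
  proof -
    define u where "u = 1 / t"
    have u: "0 < u" "u \<le> 1" using t by (auto simp: u_def)
    have tu: "u powr - \<gamma> = t powr \<gamma>" for \<gamma> using t by (simp add: u_def powr_divide powr_minus_divide)
    obtain f :: "complex ^ 'n \<Rightarrow> complex" where f: "holo_ball f"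
      "(\<integral>\<^sup>+z. ennreal (\<Phi>1 (cmod (f z))) \<partial>nu \<alpha>) \<le> ennreal X"
      "ginv \<Phi>1 (u powr - N) \<le> 2 ^ \<kappa> * cmod (f (axis k (of_real (1 - u))))"
      using X(2)[OF u] by blast
    have f1: "f \<in> bergman_orlicz \<Phi>1 \<alpha>"
      using f le_less_trans[OF f(2) ennreal_less_top] by (simp add: bergman_orlicz_def)
    define S1 S2 where "S1 = {r. 0 < r \<and> (\<integral>\<^sup>+z. ennreal (\<Phi>1 (cmod (f z) / r)) \<partial>nu \<alpha>) \<le> 1}"
      and "S2 = {r. 0 < r \<and> (\<integral>\<^sup>+z. ennreal (\<Phi>2 (cmod (f z) / r)) \<partial>nu \<beta>) \<le> 1}"
    have "R \<in> S1" using R(1) R(2)[of f 1] f by (simp add: S1_def)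
    moreover have "bdd_below S1" by (rule bdd_belowI[of _ 0]) (simp add: S1_def)
    ultimately have "lux_norm \<Phi>1 \<alpha> f \<le> R"
      unfolding lux_norm_def S1_def[symmetric] by (rule cInf_lower)
    then have "C0 * lux_norm \<Phi>1 \<alpha> f \<le> C0 * R" using C0(1) by (intro mult_left_mono) auto
    then have "Inf S2 < \<Lambda>" using C0(2)[OF f1]
      by (simp add: lux_norm_def S2_def[symmetric] \<Lambda>_def)
    \<comment> \<open>The inclusion of the spaces enters here: it is what makes the infimum of
      \<open>S2\<close> meaningful.\<close>
    moreover have "S2 \<noteq> {}"
    proof -
      have "f \<in> bergman_orlicz \<Phi>2 \<beta>" using f1 sub by blast
      from \<Phi>2.ex_modular_le_1[OF this \<beta>] show ?thesis unfolding S2_def by blast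
    qed
    ultimately obtain \<rho> where \<rho>: "\<rho> \<in> S2" "\<rho> < \<Lambda>" using cInf_lessD by blast
    have "(\<integral>\<^sup>+z. ennreal (\<Phi>2 (cmod (f z) / \<Lambda>)) \<partial>nu \<beta>) \<le> (\<integral>\<^sup>+z. ennreal (\<Phi>2 (cmod (f z) / \<rho>)) \<partial>nu \<beta>)"
      using \<rho> by (intro nn_integral_mono ennreal_leI \<Phi>2.mono divide_left_mono) (auto simp: S2_def)
    also have "\<dots> \<le> 1" using \<rho> by (simp add: S2_def)
    finally have mod2: "(\<integral>\<^sup>+z. ennreal (\<Phi>2 (cmod (f z) / \<Lambda>)) \<partial>nu \<beta>) \<le> 1" .
    define z where "z = (axis k (of_real (1 - u)) :: complex ^ 'n)"
    have "norm z = cmod (of_real (1 - u))" by (simp add: z_def norm_eq_sqrt_inner inner_axis_axis)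
    also have "\<dots> = 1 - u" using u by (simp only: norm_of_real)
    finally have nz: "norm z = 1 - u" .
    have "ginv \<Phi>1 (t powr N) \<le> cmod (f z) / \<Lambda> * (\<Lambda> * 2 ^ \<kappa>)"
      using f(3) \<Lambda> by (simp add: z_def tu mult.commute)
    then have "\<Phi>2 (ginv \<Phi>1 (t powr N)) \<le> \<Phi>2 (cmod (f z) / \<Lambda> * (\<Lambda> * 2 ^ \<kappa>))"
      using \<Phi>1.ginv(1)[of "t powr N"] by (intro \<Phi>2.mono) auto
    also have "\<dots> \<le> A2 * (\<Lambda> * 2 ^ \<kappa>) powr q2 * \<Phi>2 (cmod (f z) / \<Lambda>)"
    proof (rule \<Phi>2.upper)
      have "1 * 1 \<le> \<Lambda> * 2 ^ \<kappa>" using \<Lambda> by (intro mult_mono) auto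
      then show "1 \<le> \<Lambda> * 2 ^ \<kappa>" by simp
    qed (use \<Lambda> in auto)
    also have "\<Phi>2 (cmod (f z) / \<Lambda>) \<le> C2 * t powr M"
      using C2(2)[OF f(1) _ mod2, of z] \<Lambda> u nz by (simp add: tu)
    finally show ?thesis using \<Phi>2.A by (simp add: C_def mult_left_mono mult.assoc)
  qed
  with C show ?thesis unfolding N_def M_def by (rule that)
qed

theorem theorem4p1:
  fixes \<Phi>1 \<Phi>2 :: "real \<Rightarrow> real" and \<alpha> \<beta> :: real
  assumes "\<Phi>1 \<in> L_class \<union> U_class" and "\<Phi>2 \<in> L_class \<union> U_class"
    and "\<alpha> > -1" and "\<beta> > -1"
    and "mono_on {0<..} (\<lambda>t. \<Phi>2 t / \<Phi>1 t)"
  shows "((bergman_orlicz \<Phi>1 \<alpha> :: (complex ^ 'n \<Rightarrow> complex) set) \<subseteq> bergman_orlicz \<Phi>2 \<beta> \<and>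
          (\<exists>C>0. \<forall>f \<in> (bergman_orlicz \<Phi>1 \<alpha> :: (complex ^ 'n \<Rightarrow> complex) set).
              lux_norm \<Phi>2 \<beta> f \<le> C * lux_norm \<Phi>1 \<alpha> f))
     \<longleftrightarrow> (\<exists>C>0. \<forall>t\<ge>1. ginv \<Phi>1 (t powr (real CARD('n) + 1 + \<alpha>))
                          \<le> ginv \<Phi>2 (C * t powr (real CARD('n) + 1 + \<beta>)))"
  (is "?emb \<longleftrightarrow> ?growth")
proof -
  obtain p1 q1 A1 where \<Phi>1: "growth_type \<Phi>1 p1 q1 A1" using assms(1) by (rule L_U_imp_growth_type)
  obtain p2 q2 A2 where \<Phi>2: "growth_type \<Phi>2 p2 q2 A2" using assms(2) by (rule L_U_imp_growth_type)
  interpret \<Phi>1: growth_type \<Phi>1 p1 q1 A1 by fact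
  interpret \<Phi>2: growth_type \<Phi>2 p2 q2 A2 by fact
  define N M where "N = real CARD('n) + 1 + \<alpha>" and "M = real CARD('n) + 1 + \<beta>"
  show ?thesis
  proof
    assume ?emb
    then obtain C0 where emb: "(bergman_orlicz \<Phi>1 \<alpha> :: (complex ^ 'n \<Rightarrow> complex) set) \<subseteq> bergman_orlicz \<Phi>2 \<beta>" "C0 > 0"
      "\<And>f. f \<in> (bergman_orlicz \<Phi>1 \<alpha> :: (complex ^ 'n \<Rightarrow> complex) set) \<Longrightarrow>
        lux_norm \<Phi>2 \<beta> f \<le> C0 * lux_norm \<Phi>1 \<alpha> f"
      by blast
    then obtain C where C: "C > 0" "\<And>t. t \<ge> 1 \<Longrightarrow> \<Phi>2 (ginv \<Phi>1 (t powr N)) \<le> C * t powr M"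
      using lux_embedding_imp_growth[OF \<Phi>1 \<Phi>2 assms(3,4) emb, folded N_def M_def] by blast
    \<comment> \<open>As \<open>ginv\<close> is the least preimage, \<open>\<Phi>2 x \<le> y\<close>
      does not give \<open>x \<le> ginv \<Phi>2 y\<close> when \<open>\<Phi>2\<close> is flat at the
      level \<open>y\<close>. Enlarging \<open>C\<close> to \<open>C + 1\<close> supplies the strict
      inequality that does.\<close>
    have "ginv \<Phi>1 (t powr N) \<le> ginv \<Phi>2 ((C + 1) * t powr M)" if t: "t \<ge> 1" for t
    proof -
      have y: "(C + 1) * t powr M \<ge> 0" using C(1) by simp
      have "\<Phi>2 (ginv \<Phi>1 (t powr N)) \<le> C * t powr M" using C(2)[OF t] .
      also have "\<dots> < (C + 1) * t powr M" using t by (intro mult_strict_right_mono) auto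
      finally have "\<Phi>2 (ginv \<Phi>1 (t powr N)) < \<Phi>2 (ginv \<Phi>2 ((C + 1) * t powr M))"
        by (simp add: \<Phi>2.ginv(2)[OF y])
      then show ?thesis using \<Phi>2.less_imp_less[OF \<Phi>2.ginv(1)[OF y]] by (intro less_imp_le)
    qed
    then show ?growth using C(1) unfolding N_def M_def by (intro exI[of _ "C + 1"]) auto
  next
    assume ?growth
    then obtain C where C: "C > 0" "\<And>t. t \<ge> 1 \<Longrightarrow> ginv \<Phi>1 (t powr N) \<le> ginv \<Phi>2 (C * t powr M)"
      unfolding N_def M_def by blast
    have le: "\<Phi>2 (ginv \<Phi>1 (t powr N)) \<le> C * t powr M" if t: "t \<ge> 1" for t
      using \<Phi>2.mono[OF \<Phi>1.ginv(1) C(2)[OF t]] \<Phi>2.ginv(2)[of "C * t powr M"] C(1) by simp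
    obtain B where B: "B \<ge> 0"
      "\<And>(f :: complex ^ 'n \<Rightarrow> complex) r. holo_ball f \<Longrightarrow> r > 0 \<Longrightarrow>
        (\<integral>\<^sup>+z. ennreal (\<Phi>1 (cmod (f z) / r)) \<partial>nu \<alpha>) \<le> 1 \<Longrightarrow>
        (\<integral>\<^sup>+z. ennreal (\<Phi>2 (cmod (f z) / r)) \<partial>nu \<beta>) \<le> ennreal B"
      using modular_embedding[OF \<Phi>1 \<Phi>2 assms(3,5) C(1) le[unfolded N_def M_def]] by blast
    \<comment> \<open>The bound \<open>B\<close> may exceed 1; rescaling by \<open>R\<close> brings
      the modular below 1, and \<open>R\<close> becomes the embedding constant.\<close>
    obtain R where R: "R \<ge> 1"
      "\<And>(f :: complex ^ 'n \<Rightarrow> complex) r. holo_ball f \<Longrightarrow> r > 0 \<Longrightarrow>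
        (\<integral>\<^sup>+z. ennreal (\<Phi>2 (cmod (f z) / r)) \<partial>nu \<beta>) \<le> ennreal B \<Longrightarrow>
        (\<integral>\<^sup>+z. ennreal (\<Phi>2 (cmod (f z) / (r * R))) \<partial>nu \<beta>) \<le> 1"
      using \<Phi>2.ex_modular_scale[OF B(1) assms(4), where 'n='n] by blast
    have mem: "f \<in> bergman_orlicz \<Phi>2 \<beta> \<and> lux_norm \<Phi>2 \<beta> f \<le> R * lux_norm \<Phi>1 \<alpha> f"
      if f: "f \<in> bergman_orlicz \<Phi>1 \<alpha>" for f :: "complex ^ 'n \<Rightarrow> complex"
    proof
      have holo: "holo_ball f" using f by (simp add: bergman_orlicz_def)
      define S1 S2 where "S1 = {r. 0 < r \<and> (\<integral>\<^sup>+z. ennreal (\<Phi>1 (cmod (f z) / r)) \<partial>nu \<alpha>) \<le> 1}"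
        and "S2 = {r. 0 < r \<and> (\<integral>\<^sup>+z. ennreal (\<Phi>2 (cmod (f z) / r)) \<partial>nu \<beta>) \<le> 1}"
      have S1: "S1 \<noteq> {}" using \<Phi>1.ex_modular_le_1[OF f assms(3)] unfolding S1_def by blast
      then obtain r where r: "r \<in> S1" by blast
      have "(\<integral>\<^sup>+z. ennreal (\<Phi>2 (cmod (f z) / r)) \<partial>nu \<beta>) < \<infinity>"
        using B(2)[OF holo, of r] r le_less_trans[OF _ ennreal_less_top] by (auto simp: S1_def)
      then show "f \<in> bergman_orlicz \<Phi>2 \<beta>"
        using \<Phi>2.bergman_orlicz_iff[OF holo _ assms(4), of r] r by (simp add: S1_def)
      \<comment> \<open>Every scale \<open>s\<close> admissible for \<open>\<Phi>1\<close> yields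
        the scale \<open>s * R\<close> admissible for \<open>\<Phi>2\<close>; taking the infimum
        over the nonempty \<open>S1\<close> gives the norm inequality.\<close>
      have "lux_norm \<Phi>2 \<beta> f / R \<le> s" if s: "s \<in> S1" for s
      proof -
        have "s * R \<in> S2" using s R(1) R(2)[OF holo, of s] B(2)[OF holo, of s] by (simp add: S1_def S2_def)
        moreover have "bdd_below S2" by (rule bdd_belowI[of _ 0]) (simp add: S2_def)
        ultimately have "lux_norm \<Phi>2 \<beta> f \<le> s * R"
          unfolding lux_norm_def S2_def[symmetric] by (rule cInf_lower)
        then show ?thesis using R(1) by (simp add: field_simps)
      qed
      then have "lux_norm \<Phi>2 \<beta> f / R \<le> lux_norm \<Phi>1 \<alpha> f"
        unfolding lux_norm_def[of \<Phi>1] S1_def[symmetric] using S1 by (intro cInf_greatest)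
      then show "lux_norm \<Phi>2 \<beta> f \<le> R * lux_norm \<Phi>1 \<alpha> f" using R(1) by (simp add: field_simps)
    qed
    then show ?emb using R(1) by (intro conjI subsetI exI[of _ R]) auto
  qed
qed

end
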